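(* Let $1\le k\le n$, let $e_1,\dots,e_n$ be a basis of $\mathbb{R}^n$, and let $\Pi$ be the set of $k$-tuples $\alpha=(i_1,\dots,i_k)$ with $1\le i_1<\dots<i_k\le n$. Let $D_0\subseteq S^2(\wedge^k\mathbb{R}^n)$ be the image of the set $D$ of nonzero decomposable vectors of $\wedge^k\mathbb{R}^n$ under the map $\phi(v)=(\operatorname{sgn} v)\,v^2$. A nonzero vector $$u=\sum_{\alpha\ge\beta}q_{\alpha,\beta}\,e_{\alpha,\beta}\in S^2(\wedge^k\mathbb{R}^n),\qquad e_{\alpha,\beta}=e_\alpha\vee e_\beta,\ \alpha,\beta\in\Pi,$$ belongs to $D_0$ if and only if its coefficients satisfy all of the following relations. (i) For every $s$ with $2\le s\le k$, every subset $I\subseteq\{1,\dots,n\}$ with $|I|=k-s$, and every $j_1<j_2<\dots<j_{2s}$ in $\{1,\dots,n\}\setminus I$, the linear relations $$[j_1\,j_2\,l_1\dots l_{s-3}]_I\quad (l_1<\dots<l_{s-3}\ \text{in}\ \{j_3,\dots,j_{2s}\}),$$ $$[j_1\,j_3\,l_1\dots l_{s-3}]_I\quad (l_1<\dots<l_{s-3}\ \text{in}\ \{j_4,\dots,j_{2s}\}),$$ $$[j_2\,l_1\dots l_{s-2}]_I\quad (l_1<\dots<l_{s-2}\ \text{in}\ \{j_4,\dots,j_{2s}\})$$ hold (for $s=2$ only the single relation $[j_2]_I$ of the third kind is present). (ii) $q_{\alpha,\beta}^2-4q_{\alpha,\alpha}q_{\beta,\beta}=0$ for all distinct $\alpha,\beta\in\Pi$.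 (iii) $q_{\alpha,\beta}q_{\alpha,\gamma}-2q_{\alpha,\alpha}q_{\beta,\gamma}=0$ for all pairwise distinct $\alpha,\beta,\gamma\in\Pi$.
   Context: A nonzero vector of $\wedge^k\mathbb{R}^n$ is decomposable if it has the form $a_1\wedge\dots\wedge a_k$ with $a_i\in\mathbb{R}^n$. For $\alpha=(i_1,\dots,i_k)$ write $e_\alpha=e_{i_1}\wedge\dots\wedge e_{i_k}$; the $e_\alpha$, $\alpha\in\Pi$, form a basis of $\wedge^k\mathbb{R}^n$, ordered lexicographically starting from $e_1>e_2>\dots>e_n$, and this gives the order on $\Pi$. The vectors $e_\alpha\vee e_\beta$ with $\alpha\ge\beta$ form a basis of the symmetric square $S^2(\wedge^k\mathbb{R}^n)$. For a nonzero $v=\sum_\alpha v_\alpha e_\alpha$, $v^2=v\vee v=\sum_\alpha v_\alpha^2e_{\alpha,\alpha}+2\sum_{\alpha>\beta}v_\alpha v_\beta e_{\alpha,\beta}$, and $\operatorname{sgn}v$ is the sign of $v_\alpha$ for the maximal $\alpha$ with $v_\alpha\ne0$. Conventions for the coefficients: $q_{\alpha,\beta}=q_{\beta,\alpha}$, and $q_{\alpha,\beta}$ is extended to arbitrary $k$-tuples $\alpha,\beta$ of pairwise distinct indices so as to be alternating in the entries of $\alpha$ and in the entries of $\beta$. Notation $[\,\cdot\,]_I$: fix $I$ with $|I|=k-s$, listed in increasing order, and $j_1<\dots<j_{2s}$ outside $I$. Given $s-1$ pairwise distinct elements $p_1,\dots,p_{s-1}$ of $\{j_1,\dots,j_{2s}\}$,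 let $t_1<\dots<t_{s+1}$ be the remaining elements of $\{j_1,\dots,j_{2s}\}$. Then $[p_1\dots p_{s-1}]_I$ denotes the linear relation $$\sum_{r=1}^{s+1}(-1)^r\,q_{(I,\,t_1,\dots,\widehat{t_r},\dots,t_{s+1}),\,(I,\,t_r,\,p_1,\dots,p_{s-1})}=0,$$ where the hat means omission and $(I,\dots)$ means the tuple beginning with the elements of $I$. *)

theory Defs
  imports "HOL-Analysis.Analysis" "HOL-Library.Poly_Mapping"
begin

section \<open>Free real vector spaces\<close>

text \<open>The type \<open>'x \<Rightarrow>\<^sub>0 real\<close> is the real vector space with basis
  \<open>Poly_Mapping.single x 1\<close>, \<open>x :: 'x\<close>.\<close>

instantiation poly_mapping :: (type, real_vector) real_vector
begin

lift_definition scaleR_poly_mapping :: "real \<Rightarrow> ('a \<Rightarrow>\<^sub>0 'b) \<Rightarrow> 'a \<Rightarrow>\<^sub>0 'b"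
  is "\<lambda>c f x. c *\<^sub>R f x"
  by (erule finite_subset[rotated]) auto

instance
  by standard (transfer; simp add: scaleR_add_right scaleR_add_left fun_eq_iff)+

end

abbreviation free_vec :: "'x \<Rightarrow> 'x \<Rightarrow>\<^sub>0 real" ("\<langle>_\<rangle>") where
  "\<langle>x\<rangle> \<equiv> Poly_Mapping.single x 1"

section \<open>Exterior powers\<close>

text \<open>The exterior algebra of \<open>V\<close> is the free vector space on all finite tuples of vectors
  modulo multilinearity and vanishing on tuples with two equal entries. These relations are
  homogeneous in the length of the tuple, so the quotient is the direct sum of the exterior
  powers, and the \<open>k\<close>-th one is spanned by the classes of the \<open>k\<close>-tuples.\<close>

definition ext_relations :: "('v::real_vector list \<Rightarrow>\<^sub>0 real) set" where
  "ext_relations =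
     {\<langle>xs @ (a + b) # ys\<rangle> - \<langle>xs @ a # ys\<rangle> - \<langle>xs @ b # ys\<rangle> | xs a b ys. True}
   \<union> {\<langle>xs @ (c *\<^sub>R a) # ys\<rangle> - c *\<^sub>R \<langle>xs @ a # ys\<rangle> | xs c a ys. True}
   \<union> {\<langle>xs @ a # ys @ a # zs\<rangle> | xs a ys zs. True}"

definition ext_equiv :: "('v::real_vector list \<Rightarrow>\<^sub>0 real) \<Rightarrow> ('v list \<Rightarrow>\<^sub>0 real) \<Rightarrow> bool" where
  "ext_equiv f g \<longleftrightarrow> f - g \<in> span ext_relations"

quotient_type (overloaded) 'v exterior = "'v::real_vector list \<Rightarrow>\<^sub>0 real" / ext_equiv
proof (rule equivpI)
  show "reflp (ext_equiv :: ('v list \<Rightarrow>\<^sub>0 real) \<Rightarrow> _)"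
    by (simp add: reflp_def ext_equiv_def span_zero)
  show "symp (ext_equiv :: ('v list \<Rightarrow>\<^sub>0 real) \<Rightarrow> _)"
    unfolding symp_def ext_equiv_def by (auto dest: span_neg)
  show "transp (ext_equiv :: ('v list \<Rightarrow>\<^sub>0 real) \<Rightarrow> _)"
    unfolding transp_def ext_equiv_def by (auto dest: span_add)
qed

instantiation exterior :: (real_vector) real_vector
begin

lift_definition zero_exterior :: "'a exterior" is 0 .

lift_definition plus_exterior :: "'a exterior \<Rightarrow> 'a exterior \<Rightarrow> 'a exterior" is "(+)"
  unfolding ext_equiv_def by (drule (1) span_add) (simp add: algebra_simps)

lift_definition uminus_exterior :: "'a exterior \<Rightarrow> 'a exterior" is uminus
  unfolding ext_equiv_def by (drule span_neg) simp

lift_definition minus_exterior :: "'a exterior \<Rightarrow> 'a exterior \<Rightarrow> 'a exterior" is "(-)"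
  unfolding ext_equiv_def by (drule (1) span_diff) (simp add: algebra_simps)

lift_definition scaleR_exterior :: "real \<Rightarrow> 'a exterior \<Rightarrow> 'a exterior" is scaleR
  unfolding ext_equiv_def by (drule span_scale) (simp only: scaleR_diff_right)

instance
  by standard (transfer; simp add: algebra_simps ext_equiv_def span_zero)+

end

text \<open>\<open>wedge [a\<^sub>1, \<dots>, a\<^sub>k]\<close> is the product of \<open>a\<^sub>1, \<dots>, a\<^sub>k\<close> in the exterior algebra.\<close>

lift_definition wedge :: "'v::real_vector list \<Rightarrow> 'v exterior" is "\<lambda>as. \<langle>as\<rangle>" .

definition decomposable :: "nat \<Rightarrow> 'v::real_vector exterior set" where
  "decomposable k = {v. v \<noteq> 0 \<and> (\<exists>as. length as = k \<and> v = wedge as)}"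

section \<open>The symmetric square\<close>

definition sym2_relations :: "('w::real_vector \<times> 'w \<Rightarrow>\<^sub>0 real) set" where
  "sym2_relations =
     {\<langle>(a + b, c)\<rangle> - \<langle>(a, c)\<rangle> - \<langle>(b, c)\<rangle> | a b c. True}
   \<union> {\<langle>(r *\<^sub>R a, b)\<rangle> - r *\<^sub>R \<langle>(a, b)\<rangle> | r a b. True}
   \<union> {\<langle>(a, b)\<rangle> - \<langle>(b, a)\<rangle> | a b. True}"

definition sym2_equiv :: "('w::real_vector \<times> 'w \<Rightarrow>\<^sub>0 real) \<Rightarrow> ('w \<times> 'w \<Rightarrow>\<^sub>0 real) \<Rightarrow> bool" where
  "sym2_equiv f g \<longleftrightarrow> f - g \<in> span sym2_relations"

quotient_type (overloaded) 'w sym_square = "'w::real_vector \<times> 'w \<Rightarrow>\<^sub>0 real" / sym2_equiv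
proof (rule equivpI)
  show "reflp (sym2_equiv :: ('w \<times> 'w \<Rightarrow>\<^sub>0 real) \<Rightarrow> _)"
    by (simp add: reflp_def sym2_equiv_def span_zero)
  show "symp (sym2_equiv :: ('w \<times> 'w \<Rightarrow>\<^sub>0 real) \<Rightarrow> _)"
    unfolding symp_def sym2_equiv_def by (auto dest: span_neg)
  show "transp (sym2_equiv :: ('w \<times> 'w \<Rightarrow>\<^sub>0 real) \<Rightarrow> _)"
    unfolding transp_def sym2_equiv_def by (auto dest: span_add)
qed

instantiation sym_square :: (real_vector) real_vector
begin

lift_definition zero_sym_square :: "'a sym_square" is 0 .

lift_definition plus_sym_square :: "'a sym_square \<Rightarrow> 'a sym_square \<Rightarrow> 'a sym_square" is "(+)"
  unfolding sym2_equiv_def by (drule (1) span_add) (simp add: algebra_simps)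

lift_definition uminus_sym_square :: "'a sym_square \<Rightarrow> 'a sym_square" is uminus
  unfolding sym2_equiv_def by (drule span_neg) simp

lift_definition minus_sym_square :: "'a sym_square \<Rightarrow> 'a sym_square \<Rightarrow> 'a sym_square" is "(-)"
  unfolding sym2_equiv_def by (drule (1) span_diff) (simp add: algebra_simps)

lift_definition scaleR_sym_square :: "real \<Rightarrow> 'a sym_square \<Rightarrow> 'a sym_square" is scaleR
  unfolding sym2_equiv_def by (drule span_scale) (simp only: scaleR_diff_right)

instance
  by standard (transfer; simp add: algebra_simps sym2_equiv_def span_zero)+

end

lift_definition vee :: "'w::real_vector \<Rightarrow> 'w \<Rightarrow> 'w sym_square" (infixl "\<or>\<^sub>s" 70)
  is "\<lambda>v w. \<langle>(v, w)\<rangle>" .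

section \<open>Multi-indices, coordinates and the sign of a vector\<close>

definition multi_indices :: "nat \<Rightarrow> nat \<Rightarrow> nat list set" where
  "multi_indices n k = {\<alpha>. length \<alpha> = k \<and> sorted_wrt (<) \<alpha> \<and> set \<alpha> \<subseteq> {1..n}}"

text \<open>The order is lexicographic starting from \<open>e\<^sub>1 > e\<^sub>2 > \<dots> > e\<^sub>n\<close>, so the larger tuple is
  the one with the smaller index at the first difference.\<close>

definition mi_greater :: "nat list \<Rightarrow> nat list \<Rightarrow> bool" (infix "\<succ>" 50) where
  "\<alpha> \<succ> \<beta> \<longleftrightarrow> (\<alpha>, \<beta>) \<in> lexord less_than"

definition basis_wedge :: "(nat \<Rightarrow> 'v::real_vector) \<Rightarrow> nat list \<Rightarrow> 'v exterior" where
  "basis_wedge e \<alpha> = wedge (map e \<alpha>)"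

definition ext_coord ::
    "nat \<Rightarrow> nat \<Rightarrow> (nat \<Rightarrow> 'v::real_vector) \<Rightarrow> 'v exterior \<Rightarrow> nat list \<Rightarrow> real" where
  "ext_coord n k e v \<alpha> =
     representation (basis_wedge e ` multi_indices n k) v (basis_wedge e \<alpha>)"

definition ext_sgn :: "nat \<Rightarrow> nat \<Rightarrow> (nat \<Rightarrow> 'v::real_vector) \<Rightarrow> 'v exterior \<Rightarrow> real" where
  "ext_sgn n k e v = sgn (ext_coord n k e v
     (THE \<alpha>. \<alpha> \<in> multi_indices n k \<and> ext_coord n k e v \<alpha> \<noteq> 0 \<and>
        (\<forall>\<beta>\<in>multi_indices n k. ext_coord n k e v \<beta> \<noteq> 0 \<longrightarrow> \<beta> = \<alpha> \<or> \<alpha> \<succ> \<beta>)))"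

definition signed_square ::
    "nat \<Rightarrow> nat \<Rightarrow> (nat \<Rightarrow> 'v::real_vector) \<Rightarrow> 'v exterior \<Rightarrow> 'v exterior sym_square" where
  "signed_square n k e v = ext_sgn n k e v *\<^sub>R (v \<or>\<^sub>s v)"

section \<open>The linear relations\<close>

text \<open>The sign of the permutation that sorts a tuple, and \<open>0\<close> if an entry is repeated.\<close>

primrec tuple_sign :: "nat list \<Rightarrow> real" where
  "tuple_sign [] = 1"
| "tuple_sign (x # xs) = (\<Prod>y\<leftarrow>xs. sgn (real y - real x)) * tuple_sign xs"

text \<open>The extension of the coefficients \<open>q \<alpha> \<beta>\<close>, given for increasing \<open>\<alpha> \<ge> \<beta>\<close>, to arbitrary
  tuples: symmetric in \<open>\<alpha>, \<beta>\<close> and alternating in the entries of each. Values of \<open>q\<close> at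
  other arguments are irrelevant.\<close>

definition extend_coeff ::
    "(nat list \<Rightarrow> nat list \<Rightarrow> real) \<Rightarrow> nat list \<Rightarrow> nat list \<Rightarrow> real" where
  "extend_coeff q \<alpha> \<beta> = tuple_sign \<alpha> * tuple_sign \<beta> *
     (if sort \<beta> \<succ> sort \<alpha> then q (sort \<beta>) (sort \<alpha>) else q (sort \<alpha>) (sort \<beta>))"

lemma extend_coeff_multi_indices:
  assumes "\<alpha> \<in> multi_indices n k" "\<beta> \<in> multi_indices n k"
  shows "extend_coeff q \<alpha> \<beta> = (if \<beta> \<succ> \<alpha> then q \<beta> \<alpha> else q \<alpha> \<beta>)"
proof -
  have prod1: "(\<Prod>y\<leftarrow>ys. sgn (real y - real x)) = 1" if "\<forall>y\<in>set ys. x < y" for x :: nat and ys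
    using that by (induction ys) auto
  have sign1: "tuple_sign xs = 1" if "sorted_wrt (<) xs" for xs
    using that by (induction xs) (auto simp: prod1)
  have "sort xs = xs" if "sorted_wrt (<) xs" for xs :: "nat list"
    using that by (simp add: sorted_sort_id strict_sorted_imp_sorted)
  then show ?thesis
    using assms by (simp add: multi_indices_def extend_coeff_def sign1)
qed

lemma tuple_sign_swap: "tuple_sign (xs @ a # b # ys) = - tuple_sign (xs @ b # a # ys)"
  by (induction xs) (auto simp: sgn_if)

lemma extend_coeff_sym: "extend_coeff q \<alpha> \<beta> = extend_coeff q \<beta> \<alpha>"
proof -
  have irr: "irrefl (lexord less_than)" and tr: "trans (lexord less_than)"
    by (auto simp: irrefl_def lexord_irreflexive lexord_transI)
  have "\<not> (\<alpha>' \<succ> \<beta>' \<and> \<beta>' \<succ> \<alpha>')" for \<alpha>' \<beta>'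
    using irr tr unfolding mi_greater_def irrefl_def trans_def by blast
  then have "\<not> (sort \<alpha> \<succ> sort \<beta> \<and> sort \<beta> \<succ> sort \<alpha>)" .
  moreover have "sort \<alpha> = sort \<beta> \<or> sort \<alpha> \<succ> sort \<beta> \<or> sort \<beta> \<succ> sort \<alpha>"
  proof -
    have "\<forall>a b. (a, b) \<in> less_than \<or> a = b \<or> (b, a) \<in> less_than"
      by (simp add: less_linear)
    from lexord_linear[OF this, of "sort \<alpha>" "sort \<beta>"] show ?thesis
      unfolding mi_greater_def by blast
  qed
  ultimately show ?thesis
    unfolding extend_coeff_def by auto
qed

lemma extend_coeff_swap:
  "extend_coeff q (xs @ a # b # ys) \<beta> = - extend_coeff q (xs @ b # a # ys) \<beta>"
proof -
  have "sort (xs @ a # b # ys) = sort (xs @ b # a # ys)"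
    by (rule properties_for_sort) (auto simp: add_mset_commute)
  then show ?thesis
    by (simp add: extend_coeff_def tuple_sign_swap[of xs a b])
qed

text \<open>The left-hand side of the relation \<open>[p\<^sub>1 \<dots> p\<^bsub>s-1\<^esub>]\<^sub>I\<close>. Here \<open>js\<close> is the increasing list
  \<open>j\<^sub>1, \<dots>, j\<^bsub>2s\<^esub>\<close> and \<open>ts\<close> is \<open>t\<^sub>1, \<dots>, t\<^bsub>s+1\<^esub>\<close>. Lists are indexed from \<open>0\<close>, hence the exponent.\<close>

definition bracket ::
    "(nat list \<Rightarrow> nat list \<Rightarrow> real) \<Rightarrow> nat set \<Rightarrow> nat list \<Rightarrow> nat list \<Rightarrow> real" where
  "bracket q I js ps =
     (let ts = filter (\<lambda>j. j \<notin> set ps) js; is = sorted_list_of_set I in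
      \<Sum>r<length ts. (-1) ^ Suc r *
        extend_coeff q (is @ take r ts @ drop (Suc r) ts) (is @ ts ! r # ps))"

definition linear_relations :: "nat \<Rightarrow> nat \<Rightarrow> (nat list \<Rightarrow> nat list \<Rightarrow> real) \<Rightarrow> bool" where
  "linear_relations n k q \<longleftrightarrow>
     (\<forall>s I js. 2 \<le> s \<and> s \<le> k \<and> I \<subseteq> {1..n} \<and> card I = k - s \<and>
        length js = 2 * s \<and> sorted_wrt (<) js \<and> set js \<subseteq> {1..n} - I \<longrightarrow>
        (3 \<le> s \<longrightarrow> (\<forall>ls. length ls = s - 3 \<and> sorted_wrt (<) ls \<and> set ls \<subseteq> set (drop 2 js) \<longrightarrow>
            bracket q I js (js ! 0 # js ! 1 # ls) = 0)) \<and>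
        (3 \<le> s \<longrightarrow> (\<forall>ls. length ls = s - 3 \<and> sorted_wrt (<) ls \<and> set ls \<subseteq> set (drop 3 js) \<longrightarrow>
            bracket q I js (js ! 0 # js ! 2 # ls) = 0)) \<and>
        (\<forall>ls. length ls = s - 2 \<and> sorted_wrt (<) ls \<and> set ls \<subseteq> set (drop 3 js) \<longrightarrow>
            bracket q I js (js ! 1 # ls) = 0))"

end

theory Submission
  imports Defs "Jordan_Normal_Form.Determinant"
begin

text \<open>The relations (ii) and (iii) say that \<open>u = \<epsilon> v\<^sup>2\<close> for a vector \<open>v\<close> and a sign \<open>\<epsilon>\<close>, so that the
  linear relations become quadratic relations between the coordinates of \<open>v\<close>. For fixed \<open>I\<close> and
  \<open>J = {j\<^sub>1, \<dots>, j\<^bsub>2s\<^esub>}\<close> a suitable choice of signs \<open>y\<^bsub>A\<^esub> = \<plusminus> v\<^bsub>I \<union> A\<^esub> v\<^bsub>I \<union> (J - A)\<^esub>\<close> turns the relation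
  \<open>[P]\<^sub>I\<close> into \<open>\<Sum>\<^bsub>t \<in> J - P\<^esub> y\<^bsub>P \<union> {t}\<^esub> = 0\<close>, where \<open>y\<^bsub>J - A\<^esub> = (-1)\<^sup>s y\<^bsub>A\<^esub>\<close>. Sorting the subsets of \<open>J\<close> by their
  trace on \<open>{j\<^sub>1, j\<^sub>2, j\<^sub>3}\<close> and using inclusion-exclusion to sum over the subsets disjoint from a given
  one, the listed relations imply all of them, that is, all Pluecker relations. These determine every
  coordinate of \<open>v\<close> from a nonzero one \<open>v\<^bsub>\<alpha>\<^esub>\<close> and those at tuples differing from \<open>\<alpha>\<close> in one entry, and
  there is a decomposable vector with these prescribed coordinates.\<close>

section \<open>Functions on the subsets of a finite set\<close>

text \<open>Only some of the brackets are given, so the others must be derived by linear algebra in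
  the numbers y_A. Three indices are singled out because of a majority rule: of two complementary
  s-subsets of J exactly one contains at least two of j_1, j_2, j_3. By the complement rule, y is
  thus given by four functions on subsets of the other 2s-3 elements, one for each trace with at
  least two elements. The obstacle is a relation whose P contains just one of the three indices: it
  mixes traces of size two with traces of size one, and complementing the latter gives a sum over
  all (s-2)-sets disjoint from a given one. This sum can be evaluated because the first two families
  make the second iterate of \<open>down\<close> vanish on the functions at traces {j_1, j_2} and
  {j_1, j_3}.\<close>

definition down :: "'a set \<Rightarrow> ('a set \<Rightarrow> real) \<Rightarrow> 'a set \<Rightarrow> real" where
  "down C f Z = (\<Sum>x\<in>C - Z. f (insert x Z))"

text \<open>\<open>down\<close> and \<open>up\<close> are the lowering and raising operators of the
  subset lattice: one leads from functions on (m+1)-sets to functions on m-sets, the other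
  back.\<close>

definition up :: "('a set \<Rightarrow> real) \<Rightarrow> 'a set \<Rightarrow> real" where
  "up f B = (\<Sum>x\<in>B. f (B - {x}))"

text \<open>For finite C, Z inside C and |Z| \<le> r this is the (r - |Z|)-fold iterate of
  \<open>down C\<close> on f, divided by (r - |Z|)!. The closed form is the one that
  inclusion-exclusion produces.\<close>

definition superset_sum :: "'a set \<Rightarrow> nat \<Rightarrow> ('a set \<Rightarrow> real) \<Rightarrow> 'a set \<Rightarrow> real" where
  "superset_sum C r f Z = (\<Sum>B | B \<subseteq> C \<and> card B = r \<and> Z \<subseteq> B. f B)"

lemma superset_sum_top:
  assumes "finite C" "Z \<subseteq> C" "card Z = r"
  shows "superset_sum C r f Z = f Z"
proof -
  have "{B. B \<subseteq> C \<and> card B = r \<and> Z \<subseteq> B} = {Z}"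
    using assms card_subset_eq finite_subset by blast
  then show ?thesis by (simp add: superset_sum_def)
qed

text \<open>Double counting: a superset B of Z is counted once for every element of B - Z.\<close>

lemma sum_superset_sum_insert:
  assumes "finite C" "Z \<subseteq> C"
  shows "(\<Sum>x\<in>C - Z. superset_sum C r f (insert x Z)) = real (r - card Z) * superset_sum C r f Z"
proof -
  let ?S = "{B. B \<subseteq> C \<and> card B = r \<and> Z \<subseteq> B}"
  have finS: "finite ?S" by (rule finite_subset[of _ "Pow C"]) (use assms in auto)
  have "(\<Sum>x\<in>C - Z. superset_sum C r f (insert x Z)) = (\<Sum>x\<in>C - Z. \<Sum>B\<in>?S. if x \<in> B then f B else 0)"
  proof (rule sum.cong[OF refl])
    fix x assume "x \<in> C - Z"
    have "{B. B \<subseteq> C \<and> card B = r \<and> insert x Z \<subseteq> B} = {B \<in> ?S. x \<in> B}" by auto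
    then show "superset_sum C r f (insert x Z) = (\<Sum>B\<in>?S. if x \<in> B then f B else 0)"
      by (simp only: superset_sum_def sum.inter_filter[OF finS])
  qed
  also have "\<dots> = (\<Sum>B\<in>?S. \<Sum>x\<in>C - Z. if x \<in> B then f B else 0)" by (rule sum.swap)
  also have "\<dots> = (\<Sum>B\<in>?S. real (r - card Z) * f B)"
  proof (rule sum.cong[OF refl])
    fix B assume B: "B \<in> ?S"
    then have "{x \<in> C - Z. x \<in> B} = B - Z" by auto
    moreover have "card (B - Z) = r - card Z"
      using B assms by (auto simp: card_Diff_subset finite_subset)
    ultimately show "(\<Sum>x\<in>C - Z. if x \<in> B then f B else 0) = real (r - card Z) * f B"
      using assms by (simp flip: sum.inter_filter)
  qed
  finally show ?thesis by (simp add: superset_sum_def sum_distrib_left)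
qed

lemma superset_sum_down:
  assumes "finite C" "Z \<subseteq> C" "Suc (card Z) = r"
  shows "superset_sum C r f Z = down C f Z"
proof -
  have "finite Z" using assms finite_subset by auto
  then have "(\<Sum>x\<in>C - Z. superset_sum C r f (insert x Z)) = down C f Z"
    unfolding down_def by (intro sum.cong refl superset_sum_top) (use assms in auto)
  moreover have "real (r - card Z) = 1" using assms(3) by auto
  ultimately show ?thesis using sum_superset_sum_insert[OF assms(1,2), of r f] by simp
qed

text \<open>If the second iterate of \<open>down\<close> vanishes, so do the higher ones. The
  induction starts at size r - 2 and goes to smaller Z; the recursion can be solved for the sum at Z
  since its factor r - |Z| is not 0.\<close>

lemma superset_sum_zero:
  assumes C: "finite C"
    and dd: "\<And>Z. Z \<subseteq> C \<Longrightarrow> card Z + 2 = r \<Longrightarrow> down C (down C f) Z = 0"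
    and "Z \<subseteq> C" "card Z + 2 \<le> r"
  shows "superset_sum C r f Z = 0"
  using assms(3,4)
proof (induction "r - card Z" arbitrary: Z rule: less_induct)
  case less
  have fin: "finite Z" using less.prems C finite_subset by auto
  have "(\<Sum>x\<in>C - Z. superset_sum C r f (insert x Z)) = 0"
  proof (cases "card Z + 2 = r")
    case True
    have "(\<Sum>x\<in>C - Z. superset_sum C r f (insert x Z)) = down C (down C f) Z"
      unfolding down_def[of C "down C f"]
      by (intro sum.cong refl superset_sum_down) (use less.prems True fin C in auto)
    then show ?thesis using dd less.prems True by simp
  next
    case False
    then show ?thesis
      by (intro sum.neutral ballI less.hyps) (use less.prems fin in auto)
  qed
  then show ?case
    using sum_superset_sum_insert[OF C less.prems(1), of r f] less.prems(2) by simp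
qed

lemma sum_Pow_minus_one_power:
  assumes "finite A"
  shows "(\<Sum>Z\<in>Pow A. (-1::real) ^ card Z) = (if A = {} then 1 else 0)"
  using assms
proof (induction A rule: finite_induct)
  case (insert x A)
  have "(\<Sum>Z\<in>Pow (insert x A). (-1::real) ^ card Z)
      = (\<Sum>Z\<in>Pow A. (-1) ^ card Z) + (\<Sum>Z\<in>insert x ` Pow A. (-1) ^ card Z)"
    unfolding Pow_insert by (rule sum.union_disjoint) (use insert in auto)
  also have "(\<Sum>Z\<in>insert x ` Pow A. (-1::real) ^ card Z) = (\<Sum>Z\<in>Pow A. (-1) ^ card (insert x Z))"
    by (rule sum.reindex_cong[of "insert x"]) (use insert in \<open>auto simp: inj_on_def\<close>)
  also have "\<dots> = (\<Sum>Z\<in>Pow A. - ((-1) ^ card Z))"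
  proof (rule sum.cong[OF refl])
    fix Z assume "Z \<in> Pow A"
    then have "finite Z" "x \<notin> Z" using insert finite_subset by auto
    then show "(-1::real) ^ card (insert x Z) = - ((-1) ^ card Z)" by simp
  qed
  finally show ?case by (simp add: sum_negf)
qed simp

text \<open>After exchanging the sums, f A is multiplied by the alternating sum over all subsets of
  A \<inter> B, which is 0 unless that intersection is empty.\<close>

lemma sum_disjoint_inclusion_exclusion:
  assumes "finite C" "B \<subseteq> C"
  shows "(\<Sum>A | A \<subseteq> C \<and> card A = r \<and> A \<inter> B = {}. f A)
    = (\<Sum>Z\<in>Pow B. (-1) ^ card Z * superset_sum C r f Z)"
proof -
  let ?S = "{A. A \<subseteq> C \<and> card A = r}"
  have finS: "finite ?S" by (rule finite_subset[of _ "Pow C"]) (use assms in auto)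
  have finB: "finite B" using assms finite_subset by auto
  have "(\<Sum>Z\<in>Pow B. (-1) ^ card Z * superset_sum C r f Z)
      = (\<Sum>Z\<in>Pow B. \<Sum>A\<in>?S. if Z \<subseteq> A then (-1) ^ card Z * f A else 0)"
  proof (rule sum.cong[OF refl])
    fix Z
    have "{A. A \<subseteq> C \<and> card A = r \<and> Z \<subseteq> A} = {A \<in> ?S. Z \<subseteq> A}" by auto
    then have "superset_sum C r f Z = (\<Sum>A\<in>?S. if Z \<subseteq> A then f A else 0)"
      by (simp only: superset_sum_def sum.inter_filter[OF finS])
    then show "(-1) ^ card Z * superset_sum C r f Z
        = (\<Sum>A\<in>?S. if Z \<subseteq> A then (-1) ^ card Z * f A else 0)"
      by (simp add: sum_distrib_left if_distrib cong: if_cong)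
  qed
  also have "\<dots> = (\<Sum>A\<in>?S. \<Sum>Z\<in>Pow B. if Z \<subseteq> A then (-1) ^ card Z * f A else 0)"
    by (rule sum.swap)
  also have "\<dots> = (\<Sum>A\<in>?S. if A \<inter> B = {} then f A else 0)"
  proof (rule sum.cong[OF refl])
    fix A
    have "{Z \<in> Pow B. Z \<subseteq> A} = Pow (A \<inter> B)" by auto
    then have "(\<Sum>Z\<in>Pow B. if Z \<subseteq> A then (-1) ^ card Z * f A else 0)
        = (\<Sum>Z\<in>Pow (A \<inter> B). (-1) ^ card Z) * f A"
      using finB by (simp add: sum_distrib_right flip: sum.inter_filter)
    then show "(\<Sum>Z\<in>Pow B. if Z \<subseteq> A then (-1) ^ card Z * f A else 0) = (if A \<inter> B = {} then f A else 0)"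
      using finB by (simp add: sum_Pow_minus_one_power del: Pow_Int_eq)
  qed
  also have "\<dots> = (\<Sum>A\<in>{A\<in>?S. A \<inter> B = {}}. f A)" by (simp only: sum.inter_filter[OF finS])
  also have "{A\<in>?S. A \<inter> B = {}} = {A. A \<subseteq> C \<and> card A = r \<and> A \<inter> B = {}}" by auto
  finally show ?thesis by simp
qed

text \<open>The r-sets disjoint from B are the neighbours of B in the Kneser graph on C; as C - B
  has r + 1 elements, each of them is C - B without one point. In the inclusion-exclusion sum only Z
  = B and the sets B - {x} survive, because the superset sums vanish from size r - 2 down.\<close>

lemma kneser_sum:
  assumes C: "finite C" "card C = 2 * r + 1" and B: "B \<subseteq> C" "card B = r"
    and dd: "\<And>Z. Z \<subseteq> C \<Longrightarrow> card Z + 2 = r \<Longrightarrow> down C (down C f) Z = 0"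
  shows "(\<Sum>x\<in>C - B. f (C - B - {x})) = (-1) ^ r * (f B - up (down C f) B)"
proof -
  have finB: "finite B" using C B finite_subset by auto
  have card_CB: "card (C - B) = Suc r" using C B finB by (simp add: card_Diff_subset)
  have "(\<Sum>x\<in>C - B. f (C - B - {x})) = (\<Sum>A | A \<subseteq> C \<and> card A = r \<and> A \<inter> B = {}. f A)"
  proof (rule sum.reindex_cong[of "\<lambda>x. C - B - {x}", symmetric])
    show "inj_on (\<lambda>x. C - B - {x}) (C - B)" by (auto simp: inj_on_def)
    show "{A. A \<subseteq> C \<and> card A = r \<and> A \<inter> B = {}} = (\<lambda>x. C - B - {x}) ` (C - B)" (is "?L = ?R")
    proof
      show "?L \<subseteq> ?R"
      proof
        fix A assume A: "A \<in> ?L"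
        then have sub: "A \<subseteq> C - B" by auto
        then have "card (C - B - A) = 1"
          using A C card_CB by (subst card_Diff_subset) (auto intro: finite_subset)
        then obtain x where x: "C - B - A = {x}" by (auto simp: card_1_singleton_iff)
        then have "x \<in> C - B" "A = C - B - {x}" using sub by auto
        then show "A \<in> ?R" by blast
      qed
      show "?R \<subseteq> ?L" using card_CB C by auto
    qed
  qed simp
  also have "\<dots> = (\<Sum>Z\<in>Pow B. (-1) ^ card Z * superset_sum C r f Z)"
    by (rule sum_disjoint_inclusion_exclusion) fact+
  also have "\<dots> = (\<Sum>Z\<in>insert B ((\<lambda>x. B - {x}) ` B). (-1) ^ card Z * superset_sum C r f Z)"
  proof (rule sum.mono_neutral_right)
    show "\<forall>Z\<in>Pow B - insert B ((\<lambda>x. B - {x}) ` B). (-1) ^ card Z * superset_sum C r f Z = 0"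
    proof
      fix Z assume Z: "Z \<in> Pow B - insert B ((\<lambda>x. B - {x}) ` B)"
      then have finZ: "finite Z" and ZB: "Z \<subseteq> B" "Z \<noteq> B" using finB finite_subset by auto
      have "card (B - Z) = r - card Z" using finZ ZB B by (simp add: card_Diff_subset)
      moreover have "card (B - Z) \<noteq> 0" using ZB finB by auto
      moreover have "card (B - Z) \<noteq> 1"
      proof
        assume "card (B - Z) = 1"
        then obtain x where "B - Z = {x}" by (auto simp: card_1_singleton_iff)
        then have "x \<in> B" "Z = B - {x}" using ZB by auto
        then show False using Z by auto
      qed
      ultimately have "card Z + 2 \<le> r" by auto
      then show "(-1) ^ card Z * superset_sum C r f Z = 0"
        using superset_sum_zero[OF C(1), of r f Z] dd ZB B by auto
    qed
  qed (use finB in auto)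
  also have "\<dots> = (-1) ^ r * f B + (\<Sum>Z\<in>(\<lambda>x. B - {x}) ` B. (-1) ^ card Z * superset_sum C r f Z)"
    using finB B C by (subst sum.insert) (auto simp: superset_sum_top)
  also have "(\<Sum>Z\<in>(\<lambda>x. B - {x}) ` B. (-1) ^ card Z * superset_sum C r f Z)
      = (\<Sum>x\<in>B. - ((-1) ^ r * down C f (B - {x})))"
  proof (rule sum.reindex_cong[of "\<lambda>x. B - {x}"])
    fix x assume x: "x \<in> B"
    then have "Suc (card (B - {x})) = r" using finB B by (metis card_Suc_Diff1)
    moreover from this have "(-1::real) ^ card (B - {x}) = - ((-1) ^ r)" by (metis minus_equation_iff mult_minus1 power_Suc)
    ultimately show "(-1) ^ card (B - {x}) * superset_sum C r f (B - {x}) = - ((-1) ^ r * down C f (B - {x}))"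
      using C B by (subst superset_sum_down) auto
  qed (auto simp: inj_on_def)
  finally show ?thesis
    by (simp add: up_def sum_negf sum_distrib_left right_diff_distrib)
qed

text \<open>The commutator of lowering and raising acts on functions of m-sets in C as |C| - 2m.
  Here m = r - 1 and |C| = 2r + 1, so the constant is 3, and \<open>up (down C g)\<close> drops
  out.\<close>

lemma down_up:
  assumes C: "finite C" "card C = 2 * r + 1" and Z: "Z \<subseteq> C" "Suc (card Z) = r"
    and d: "\<And>Z. Z \<subseteq> C \<Longrightarrow> card Z + 2 = r \<Longrightarrow> down C g Z = 0"
  shows "down C (up g) Z = 3 * g Z"
proof -
  have finZ: "finite Z" using C Z finite_subset by auto
  have "down C (up g) Z = (\<Sum>x\<in>C - Z. g Z + (\<Sum>z\<in>Z. g (insert x (Z - {z}))))"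
    unfolding down_def
  proof (rule sum.cong[OF refl])
    fix x assume x: "x \<in> C - Z"
    have "up g (insert x Z) = g (insert x Z - {x}) + (\<Sum>z\<in>Z. g (insert x Z - {z}))"
      unfolding up_def using x finZ by simp
    moreover have "insert x Z - {z} = insert x (Z - {z})" if "z \<in> Z" for z using that x by auto
    moreover have "insert x Z - {x} = Z" using x by auto
    ultimately show "up g (insert x Z) = g Z + (\<Sum>z\<in>Z. g (insert x (Z - {z})))" by simp
  qed
  also have "\<dots> = real (card (C - Z)) * g Z + (\<Sum>z\<in>Z. \<Sum>x\<in>C - Z. g (insert x (Z - {z})))"
    by (simp add: sum.distrib sum.swap[of _ Z])
  \<comment> \<open>The vanishing sum \<open>down C g (Z - {z})\<close> also has the insertion of z
    itself, and that term is \<open>g Z\<close>.\<close>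
  also have "(\<Sum>z\<in>Z. \<Sum>x\<in>C - Z. g (insert x (Z - {z}))) = (\<Sum>z\<in>Z. - g Z)"
  proof (rule sum.cong[OF refl])
    fix z assume z: "z \<in> Z"
    have "card (Z - {z}) + 2 = r" using z Z finZ by (metis add_2_eq_Suc' card_Suc_Diff1)
    then have "0 = down C g (Z - {z})" using d[of "Z - {z}"] Z by auto
    also have "C - (Z - {z}) = insert z (C - Z)" using z Z by auto
    then have "down C g (Z - {z}) = g (insert z (Z - {z})) + (\<Sum>x\<in>C - Z. g (insert x (Z - {z})))"
      unfolding down_def using C z by simp
    also have "insert z (Z - {z}) = Z" using z by auto
    finally show "(\<Sum>x\<in>C - Z. g (insert x (Z - {z}))) = - g Z" by simp
  qed
  also have "card (C - Z) = r + 2" using C Z finZ by (subst card_Diff_subset) auto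
  finally show ?thesis using Z(2) by (auto simp: algebra_simps)
qed

lemma down_vanishes:
  fixes y :: "'a set \<Rightarrow> real"
  assumes J: "finite J" "card J = 2 * s" "2 \<le> s"
    and j: "{j0, j1, j2} \<subseteq> J" "j0 \<noteq> j1" "j0 \<noteq> j2" "j1 \<noteq> j2"
    and compl: "\<And>A. A \<subseteq> J \<Longrightarrow> card A = s \<Longrightarrow> y (J - A) = (-1) ^ s * y A"
    and h01: "\<And>P. P \<subseteq> J \<Longrightarrow> Suc (card P) = s \<Longrightarrow> j0 \<in> P \<Longrightarrow> j1 \<in> P \<Longrightarrow> down J y P = 0"
    and h02: "\<And>P. P \<subseteq> J \<Longrightarrow> Suc (card P) = s \<Longrightarrow> j0 \<in> P \<Longrightarrow> j2 \<in> P \<Longrightarrow> j1 \<notin> P \<Longrightarrow> down J y P = 0"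
    and h1: "\<And>P. P \<subseteq> J \<Longrightarrow> Suc (card P) = s \<Longrightarrow> j1 \<in> P \<Longrightarrow> j0 \<notin> P \<Longrightarrow> j2 \<notin> P \<Longrightarrow> down J y P = 0"
    and P: "P \<subseteq> J" "Suc (card P) = s"
  shows "down J y P = 0"
proof -
  txt \<open>\<open>a\<close>, \<open>b\<close>, \<open>c\<close> and \<open>g\<close> below are the parts of \<open>y\<close> on sets with trace \<open>{j0, j1}\<close>, \<open>{j0, j2}\<close>, \<open>{j1, j2}\<close> and
    \<open>{j0, j1, j2}\<close>. The hypotheses give \<open>d a = d b = - g\<close> and \<open>d g = 0\<close> for \<open>d = down C\<close>, and with
    \<open>kneser_sum\<close> the third one becomes \<open>a + b + c + up g = 0\<close>, which is symmetric in \<open>j0, j1, j2\<close>; since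
    \<open>d (up g) = 3 g\<close>, also \<open>d c = - g\<close>.\<close>
  define C where "C = J - {j0, j1, j2}"
  define r where "r = s - 2"
  have s: "s = Suc (Suc r)" using J(3) by (simp add: r_def)
  have finC: "finite C" using J by (simp add: C_def)
  have J_eq: "J = insert j0 (insert j1 (insert j2 C))" using j by (auto simp: C_def)
  have notin: "j0 \<notin> C" "j1 \<notin> C" "j2 \<notin> C" by (auto simp: C_def)
  have cardC: "card C = 2 * r + 1"
    using J(2) finC notin j unfolding J_eq s by simp
  define a b c g where abcg: "a = (\<lambda>B. y (insert j0 (insert j1 B)))" "b = (\<lambda>B. y (insert j0 (insert j2 B)))"
    "c = (\<lambda>B. y (insert j1 (insert j2 B)))" "g = (\<lambda>B. y (insert j0 (insert j1 (insert j2 B))))"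
  have finZ: "finite Z" if "Z \<subseteq> C" for Z using that finC finite_subset by auto
  have nj: "j0 \<notin> Z" "j1 \<notin> Z" "j2 \<notin> Z" if "Z \<subseteq> C" for Z using that notin by auto
  note ne = j(2-4) j(2-4)[symmetric]
  \<comment> \<open>The part \<open>down C\<close> collects the insertions from C; the remaining
    summands insert those of j0, j1, j2 that the set lacks.\<close>
  have D: "down J y Z = down C y Z + y (insert j0 Z) + y (insert j1 Z) + y (insert j2 Z)"
    "down J y (insert j0 Z) = down C (\<lambda>B. y (insert j0 B)) Z + a Z + b Z"
    "down J y (insert j1 Z) = down C (\<lambda>B. y (insert j1 B)) Z + a Z + c Z"
    "down J y (insert j2 Z) = down C (\<lambda>B. y (insert j2 B)) Z + b Z + c Z"
    "down J y (insert j0 (insert j1 Z)) = down C a Z + g Z"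
    "down J y (insert j0 (insert j2 Z)) = down C b Z + g Z"
    "down J y (insert j1 (insert j2 Z)) = down C c Z + g Z"
    "down J y (insert j0 (insert j1 (insert j2 Z))) = down C g Z"
    if Z: "Z \<subseteq> C" for Z
  proof -
    have e: "J - Z = insert j0 (insert j1 (insert j2 (C - Z)))"
      "J - insert j0 Z = insert j1 (insert j2 (C - Z))"
      "J - insert j1 Z = insert j0 (insert j2 (C - Z))"
      "J - insert j2 Z = insert j0 (insert j1 (C - Z))"
      "J - insert j0 (insert j1 Z) = insert j2 (C - Z)"
      "J - insert j0 (insert j2 Z) = insert j1 (C - Z)"
      "J - insert j1 (insert j2 Z) = insert j0 (C - Z)"
      "J - insert j0 (insert j1 (insert j2 Z)) = C - Z"
      unfolding J_eq using nj[OF Z] ne notin by auto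
    show "down J y Z = down C y Z + y (insert j0 Z) + y (insert j1 Z) + y (insert j2 Z)"
      "down J y (insert j0 Z) = down C (\<lambda>B. y (insert j0 B)) Z + a Z + b Z"
      "down J y (insert j1 Z) = down C (\<lambda>B. y (insert j1 B)) Z + a Z + c Z"
      "down J y (insert j2 Z) = down C (\<lambda>B. y (insert j2 B)) Z + b Z + c Z"
      "down J y (insert j0 (insert j1 Z)) = down C a Z + g Z"
      "down J y (insert j0 (insert j2 Z)) = down C b Z + g Z"
      "down J y (insert j1 (insert j2 Z)) = down C c Z + g Z"
      "down J y (insert j0 (insert j1 (insert j2 Z))) = down C g Z"
      unfolding down_def e
      using finC ne notin
      by (simp_all add: abcg insert_commute)
  qed
  have sub: "insert i Z \<subseteq> J" if "i \<in> {j0, j1, j2}" "Z \<subseteq> J" for i Z using that j by auto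
  have CJ: "Z \<subseteq> J" if "Z \<subseteq> C" for Z using that by (auto simp: C_def)
  have da: "down C a Z = - g Z" and db: "down C b Z = - g Z" if Z: "Z \<subseteq> C" "Suc (card Z) = r" for Z
    using h01[of "insert j0 (insert j1 Z)"] h02[of "insert j0 (insert j2 Z)"] D[OF Z(1)] Z nj[OF Z(1)] ne
      finZ[OF Z(1)] sub CJ[OF Z(1)] s by auto
  have dg: "down C g Z = 0" if Z: "Z \<subseteq> C" "card Z + 2 = r" for Z
    using h01[of "insert j0 (insert j1 (insert j2 Z))"] D[OF Z(1)] Z nj[OF Z(1)] ne
      finZ[OF Z(1)] sub CJ[OF Z(1)] s by auto
  have dd: "down C (down C f) Z = 0"
    if f: "\<And>Z. Z \<subseteq> C \<Longrightarrow> Suc (card Z) = r \<Longrightarrow> down C f Z = - g Z" and Z: "Z \<subseteq> C" "card Z + 2 = r" for f Z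
  proof -
    have "down C (down C f) Z = (\<Sum>x\<in>C - Z. - g (insert x Z))"
      unfolding down_def[of C "down C f"] by (intro sum.cong refl f) (use Z finZ in auto)
    also have "\<dots> = - down C g Z" by (simp add: down_def sum_negf)
    finally show ?thesis using dg Z by simp
  qed
  have kneser: "(\<Sum>x\<in>C - B. f (C - B - {x})) = (-1) ^ r * (f B + up g B)"
    if f: "\<And>Z. Z \<subseteq> C \<Longrightarrow> Suc (card Z) = r \<Longrightarrow> down C f Z = - g Z" and B: "B \<subseteq> C" "card B = r" for f B
  proof -
    have "Suc (card (B - {x})) = r" if "x \<in> B" for x
      using card_Suc_Diff1[OF finZ[OF B(1)] that] B by simp
    then have "up (down C f) B = (\<Sum>x\<in>B. - g (B - {x}))"
      unfolding up_def by (intro sum.cong refl f) (use B in auto)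
    then show ?thesis
      using kneser_sum[OF finC cardC B dd[OF f]] by (simp add: up_def sum_negf)
  qed
  \<comment> \<open>Complementation in J turns trace {i} into trace {l, m}; the sign is
    \<open>(-1) ^ r\<close> since s = r + 2.\<close>
  have star: "y (insert i (insert x B)) = (-1) ^ r * y (insert l (insert m (C - B - {x})))"
    if "B \<subseteq> C" "card B = r" "x \<in> C - B" "(i, l, m) \<in> {(j0, j1, j2), (j1, j0, j2), (j2, j0, j1)}" for i l m x B
  proof -
    have il: "i \<noteq> l" "i \<noteq> m" "l \<noteq> m" using that(4) ne by auto
    have inC: "i \<notin> C" "l \<notin> C" "m \<notin> C" using that(4) notin by auto
    have J': "J = insert i (insert l (insert m C))" using that(4) unfolding J_eq by auto
    have "J - insert i (insert x B) = insert l (insert m (C - B - {x}))"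
      unfolding J' using il inC that(1,3) by auto
    moreover have "card (insert i (insert x B)) = s"
      using that finZ[OF that(1)] inC s by (subst card_insert_disjoint) auto
    moreover have "insert i (insert x B) \<subseteq> J" using that(1,3) by (auto simp: J')
    ultimately have "y (insert l (insert m (C - B - {x}))) = (-1) ^ s * y (insert i (insert x B))"
      using compl by metis
    then show ?thesis by (cases "even r") (simp_all add: s)
  qed
  have star_sum: "down C (\<lambda>B. y (insert i B)) B = (\<Sum>x\<in>C - B. (-1) ^ r * y (insert l (insert m (C - B - {x}))))"
    if "B \<subseteq> C" "card B = r" "(i, l, m) \<in> {(j0, j1, j2), (j1, j0, j2), (j2, j0, j1)}" for i l m B
    unfolding down_def by (intro sum.cong refl star) (use that in auto)
  \<comment> \<open>This is the third hypothesis at B with j1 added; its insertions from C become a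
    Kneser sum of \<open>b\<close>.\<close>
  have c: "c B = - a B - b B - up g B" if B: "B \<subseteq> C" "card B = r" for B
  proof -
    have "down C (\<lambda>B. y (insert j1 B)) B = (-1) ^ r * (\<Sum>x\<in>C - B. b (C - B - {x}))"
      using star_sum[OF B, of j1 j0 j2] by (auto simp: sum_distrib_left abcg)
    also have "\<dots> = b B + up g B" using kneser[OF db B] by simp
    finally show ?thesis using h1[of "insert j1 B"] D(3)[OF B(1)] B nj[OF B(1)] ne
      finZ[OF B(1)] sub CJ[OF B(1)] s by auto
  qed
  have dc: "down C c Z = - g Z" if Z: "Z \<subseteq> C" "Suc (card Z) = r" for Z
  proof -
    have "down C c Z = (\<Sum>x\<in>C - Z. - a (insert x Z) - b (insert x Z) - up g (insert x Z))"
      unfolding down_def by (intro sum.cong refl c) (use Z finZ in auto)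
    also have "\<dots> = - down C a Z - down C b Z - down C (up g) Z"
      by (simp add: down_def sum_subtractf sum_negf)
    also have "\<dots> = - g Z" using da[OF Z] db[OF Z] down_up[OF finC cardC Z dg] by simp
    finally show ?thesis .
  qed
  \<comment> \<open>Now all three trace-two functions satisfy the premise of \<open>kneser\<close>,
    so the relation at any P with a single distinguished element reduces to a + b + c + up g =
    0.\<close>
  have down_one: "down C (\<lambda>B. y (insert i B)) B = y (insert l (insert m B)) + up g B"
    if B: "B \<subseteq> C" "card B = r" and ilm: "(i, l, m) \<in> {(j0, j1, j2), (j1, j0, j2), (j2, j0, j1)}" for i l m B
  proof -
    define f where "f = (\<lambda>B. y (insert l (insert m B)))"
    have "f = a \<or> f = b \<or> f = c" using ilm by (auto simp: f_def abcg)
    then have f: "down C f Z = - g Z" if "Z \<subseteq> C" "Suc (card Z) = r" for Z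
      using da db dc that by auto
    have "down C (\<lambda>B. y (insert i B)) B = (-1) ^ r * (\<Sum>x\<in>C - B. f (C - B - {x}))"
      using star_sum[OF B, of i l m] ilm by (auto simp: sum_distrib_left f_def insert_commute)
    also have "\<dots> = f B + up g B" using kneser[OF f B] by simp
    finally show ?thesis by (simp add: f_def)
  qed
  define Z where "Z = P - {j0, j1, j2}"
  have Z: "Z \<subseteq> C" using P by (auto simp: Z_def C_def)
  have cZ: "card P = card Z + card (P \<inter> {j0, j1, j2})"
    unfolding Z_def by (metis Int_Diff_Un P(1) J(1) card_Un_disjoint finite_Diff finite_Int finite_subset Int_Diff_disjoint add.commute)
  consider "P = Z" "Suc (card Z) = s" | i where "i \<in> {j0, j1, j2}" "P = insert i Z" "card Z = r"
    | "P = insert j0 (insert j1 Z)" "Suc (card Z) = r" | "P = insert j0 (insert j2 Z)" "Suc (card Z) = r"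
    | "P = insert j1 (insert j2 Z)" "Suc (card Z) = r"
    | "P = insert j0 (insert j1 (insert j2 Z))" "card Z + 2 = r"
  proof -
    define S where "S = P \<inter> {j0, j1, j2}"
    have PS: "P = S \<union> Z" and cS: "Suc (card Z + card S) = s" using cZ P(2) by (auto simp: Z_def S_def)
    have "S = {} \<or> S = {j0} \<or> S = {j1} \<or> S = {j2} \<or> S = {j0, j1} \<or> S = {j0, j2} \<or> S = {j1, j2} \<or> S = {j0, j1, j2}"
      unfolding S_def by (cases "j0 \<in> P"; cases "j1 \<in> P"; cases "j2 \<in> P"; auto)
    then show ?thesis
      using PS cS that(1,3-6) that(2)[of j0] that(2)[of j1] that(2)[of j2] ne s
      by (elim disjE) simp_all
  qed
  then show ?thesis
  proof cases
    \<comment> \<open>P avoids j0, j1, j2. Its complement B in C has r elements, and complementing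
      every term gives \<open>(-1) ^ r\<close> times a + b + c + up g at B.\<close>
    case 1
    define B where "B = C - Z"
    have B: "B \<subseteq> C" "card B = r" and Z_eq: "Z = C - B"
      using Z cardC 1(2) s finZ[OF Z] finC by (auto simp: B_def card_Diff_subset)
    have "y (insert i Z) = (-1) ^ r * y (insert l (insert m B))" if "(i, l, m) \<in> {(j0, j1, j2), (j1, j0, j2), (j2, j0, j1)}" for i l m
    proof -
      have il: "i \<noteq> l" "i \<noteq> m" "l \<noteq> m" using that ne by auto
      have inC: "i \<notin> C" "l \<notin> C" "m \<notin> C" using that notin by auto
      have J': "J = insert i (insert l (insert m C))" using that unfolding J_eq by auto
      have "J - insert l (insert m B) = insert i Z"
        unfolding J' Z_eq using il inC B(1) by auto
      moreover have "card (insert l (insert m B)) = s"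
      proof -
        have "l \<notin> B" "m \<notin> B" using inC B by auto
        then show ?thesis using B finZ[OF B(1)] il s by simp
      qed
      moreover have "insert l (insert m B) \<subseteq> J" using B by (auto simp: J')
      ultimately have "y (insert i Z) = (-1) ^ s * y (insert l (insert m B))"
        using compl by metis
      then show ?thesis by (simp add: s)
    qed
    from this[of j0 j1 j2] this[of j1 j0 j2] this[of j2 j0 j1]
    have y3: "y (insert j0 Z) = (-1) ^ r * c B" "y (insert j1 Z) = (-1) ^ r * b B" "y (insert j2 Z) = (-1) ^ r * a B"
      by (auto simp: abcg)
    have "down C y Z = (\<Sum>x\<in>B. (-1) ^ r * g (B - {x}))"
      unfolding down_def
    proof (rule sum.cong)
      fix x assume x: "x \<in> B"
      have "J - insert j0 (insert j1 (insert j2 (B - {x}))) = insert x Z"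
        unfolding J_eq Z_eq using B notin x by auto
      moreover have "card (insert j0 (insert j1 (insert j2 (B - {x})))) = s"
        using B nj[OF B(1)] ne finZ[OF B(1)] x s card_Suc_Diff1[of B x] by auto
      moreover have "insert j0 (insert j1 (insert j2 (B - {x}))) \<subseteq> J" using B by (auto simp: J_eq)
      ultimately have "y (insert x Z) = (-1) ^ s * y (insert j0 (insert j1 (insert j2 (B - {x}))))"
        using compl by metis
      then show "y (insert x Z) = (-1) ^ r * g (B - {x})" by (simp add: s abcg)
    qed (simp add: B_def)
    then have "down C y Z = (-1) ^ r * up g B" by (simp add: up_def sum_distrib_left)
    then have "down J y Z = (-1) ^ r * (up g B + c B + b B + a B)"
      using D(1)[OF Z] y3 by (simp add: algebra_simps)
    then show ?thesis using c[OF B] 1 by simp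
  next
    case (2 i)
    then show ?thesis
      using D(2-4)[OF Z] c[OF Z 2(3)] down_one[OF Z 2(3), of j0 j1 j2]
        down_one[OF Z 2(3), of j1 j0 j2] down_one[OF Z 2(3), of j2 j0 j1]
      by (auto simp: abcg)
  next
    case 3 then show ?thesis using D[OF Z] da[OF Z] by simp
  next
    case 4 then show ?thesis using D[OF Z] db[OF Z] by simp
  next
    case 5 then show ?thesis using D[OF Z] dc[OF Z] by simp
  next
    case 6 then show ?thesis using D[OF Z] dg[OF Z] by simp
  qed
qed

section \<open>Signs and the Pluecker relations\<close>

text \<open>For finite disjoint X and Y this is -1 to the number of inversions when X is listed
  before Y.\<close>

definition cross_sign :: "nat set \<Rightarrow> nat set \<Rightarrow> real" where
  "cross_sign X Y = (\<Prod>x\<in>X. \<Prod>y\<in>Y. sgn (real y - real x))"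

lemma cross_sign_insert_left:
  "finite X \<Longrightarrow> x \<notin> X \<Longrightarrow> cross_sign (insert x X) Y = cross_sign {x} Y * cross_sign X Y"
  by (simp add: cross_sign_def)

lemma cross_sign_Un_right:
  "finite Y \<Longrightarrow> finite Z \<Longrightarrow> Y \<inter> Z = {} \<Longrightarrow> cross_sign X (Y \<union> Z) = cross_sign X Y * cross_sign X Z"
  by (simp add: cross_sign_def prod.union_disjoint prod.distrib)

lemma cross_sign_mult_self:
  assumes "X \<inter> Y = {}"
  shows "cross_sign X Y * cross_sign X Y = 1"
proof -
  have "cross_sign X Y * cross_sign X Y
      = (\<Prod>x\<in>X. \<Prod>y\<in>Y. sgn (real y - real x) * sgn (real y - real x))"
    by (simp only: cross_sign_def prod.distrib)
  also have "\<dots> = 1"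
    by (intro prod.neutral ballI) (use assms in \<open>auto simp: sgn_if\<close>)
  finally show ?thesis .
qed

lemma cross_sign_swap:
  assumes "finite X" "finite Y"
  shows "cross_sign Y X = (-1) ^ (card X * card Y) * cross_sign X Y"
proof -
  have "cross_sign Y X = (\<Prod>x\<in>X. \<Prod>y\<in>Y. sgn (real x - real y))"
    unfolding cross_sign_def by (rule prod.swap)
  also have "\<dots> = (\<Prod>x\<in>X. \<Prod>y\<in>Y. (-1) * sgn (real y - real x))"
    by (intro prod.cong refl) (simp add: sgn_if)
  also have "\<dots> = (-1) ^ (card X * card Y) * cross_sign X Y"
    unfolding prod.distrib cross_sign_def by (simp add: mult.commute flip: power_mult)
  finally show ?thesis .
qed

text \<open>Inversions of a concatenation lie within one part or between the two. Distinctness lets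
  products over list entries pass to the sets in \<open>cross_sign\<close>.\<close>

lemma tuple_sign_append:
  assumes "distinct xs" "distinct ys"
  shows "tuple_sign (xs @ ys) = tuple_sign xs * cross_sign (set xs) (set ys) * tuple_sign ys"
  using assms(1)
proof (induction xs)
  case (Cons x xs)
  have single: "(\<Prod>y\<leftarrow>zs. sgn (real y - real x)) = cross_sign {x} (set zs)" if "distinct zs" for zs
    using that by (simp add: cross_sign_def prod.distinct_set_conv_list)
  have "cross_sign (set (x # xs)) (set ys) = cross_sign {x} (set ys) * cross_sign (set xs) (set ys)"
    using Cons.prems by (simp add: cross_sign_insert_left[of "set xs"])
  then show ?case
    using Cons assms(2) single[of xs] single[of ys] by simp
qed (simp add: cross_sign_def)

lemma tuple_sign_Cons:
  "distinct xs \<Longrightarrow> tuple_sign (x # xs) = cross_sign {x} (set xs) * tuple_sign xs"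
  by (simp add: cross_sign_def prod.distinct_set_conv_list)

lemma tuple_sign_sorted: "sorted_wrt (<) xs \<Longrightarrow> tuple_sign xs = 1"
proof (induction xs)
  case (Cons x xs)
  have "(\<Prod>y\<leftarrow>xs. sgn (real y - real x)) = (\<Prod>y\<leftarrow>xs. 1)"
    by (intro arg_cong[of _ _ prod_list] map_cong refl) (use Cons.prems in auto)
  also have "\<dots> = 1" by (induction xs) auto
  finally show ?case using Cons by simp
qed simp

lemma tuple_sign_mult_self:
  assumes "distinct xs"
  shows "tuple_sign xs * tuple_sign xs = 1"
  using assms
proof (induction xs)
  case (Cons x xs)
  then show ?case
    using cross_sign_mult_self[of "{x}" "set xs"]
    by (simp add: tuple_sign_Cons del: tuple_sign.simps)
      (metis (no_types, lifting) mult.assoc mult.left_commute mult_1)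
qed simp

lemma eq_minus_self_imp_zero: "x = 0" if "x = - x" for x :: "'b::real_vector"
proof -
  have "2 *\<^sub>R x = 0" using that by (metis add.right_inverse scaleR_2)
  then show ?thesis by simp
qed

text \<open>The entry y moves right past one smaller entry at a time, each step flipping the sign.
  Meeting an equal entry makes both sides 0: the right one by sgn 0 = 0, the left one by
  antisymmetry.\<close>

lemma alternating_insort:
  fixes F :: "nat list \<Rightarrow> 'b::real_vector"
  assumes swap: "\<And>xs a b ys. F (xs @ a # b # ys) = - F (xs @ b # a # ys)"
    and "sorted zs"
  shows "F (xs @ y # zs) = (\<Prod>z\<leftarrow>zs. sgn (real z - real y)) *\<^sub>R F (xs @ insort y zs)"
  using assms(2)
proof (induction zs arbitrary: xs)
  case (Cons z zs)
  consider "y < z" | "y = z" | "z < y" by linarith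
  then show ?case
  proof cases
    case 1
    have "(\<Prod>z\<leftarrow>zs. sgn (real z - real y)) = (\<Prod>z\<leftarrow>zs. 1)"
      by (intro arg_cong[of _ _ prod_list] map_cong refl) (use 1 Cons.prems in auto)
    also have "\<dots> = 1" by (induction zs) auto
    finally show ?thesis using 1 by simp
  next
    case 2
    then show ?thesis using eq_minus_self_imp_zero[OF swap[of xs y y zs]] by simp
  next
    case 3
    have "F (xs @ y # z # zs) = - F ((xs @ [z]) @ y # zs)" using swap[of xs y z zs] by simp
    also have "\<dots> = - (\<Prod>z\<leftarrow>zs. sgn (real z - real y)) *\<^sub>R F (xs @ z # insort y zs)"
      using Cons.IH[of "xs @ [z]"] Cons.prems by simp
    finally show ?thesis using 3 by simp
  qed
qed simp

lemma alternating_sort_append: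
  fixes F :: "nat list \<Rightarrow> 'b::real_vector"
  assumes swap: "\<And>xs a b ys. F (xs @ a # b # ys) = - F (xs @ b # a # ys)"
  shows "F (xs @ ts) = tuple_sign ts *\<^sub>R F (xs @ sort ts)"
proof (induction ts arbitrary: xs)
  case (Cons t ts)
  have "(\<Prod>z\<leftarrow>sort ts. sgn (real z - real t)) = (\<Prod>z\<leftarrow>ts. sgn (real z - real t))"
    by (simp flip: prod_mset_prod_list add: mset_map[symmetric] del: mset_map)
      (simp add: mset_map)
  then show ?case
    using Cons.IH[of "xs @ [t]"] alternating_insort[of F "sort ts" xs t, OF swap]
    by (simp add: mult.commute)
qed simp

text \<open>With values in a real vector space, one statement serves both the minors and the wedge
  products of basis vectors.\<close>

lemma alternating_sort:
  fixes F :: "nat list \<Rightarrow> 'b::real_vector"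
  assumes "\<And>xs a b ys. F (xs @ a # b # ys) = - F (xs @ b # a # ys)"
  shows "F ts = tuple_sign ts *\<^sub>R F (sort ts)"
  using alternating_sort_append[of F "[]" ts, OF assms] by simp

section \<open>The Pluecker relations indexed by sets, and their match with the brackets\<close>

definition plucker_term :: "(nat set \<Rightarrow> real) \<Rightarrow> nat set \<Rightarrow> nat set \<Rightarrow> nat set \<Rightarrow> real" where
  "plucker_term w I J A = cross_sign (J - A) A * (w (I \<union> A) * w (I \<union> (J - A)))"

text \<open>Passing to the complement exchanges the two coordinates and the two arguments of the
  cross sign; \<open>s * s\<close> has the parity of s.\<close>

lemma plucker_term_compl:
  assumes "finite J" "card J = 2 * s" "A \<subseteq> J" "card A = s"
  shows "plucker_term w I J (J - A) = (-1) ^ s * plucker_term w I J A"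
proof -
  have "finite A" using assms finite_subset by auto
  moreover have "card (J - A) = s" using assms calculation by (simp add: card_Diff_subset)
  moreover have "J - (J - A) = A" using assms by auto
  moreover have "(-1::real) ^ (s * s) = (-1) ^ s" by (cases "even s") auto
  ultimately show ?thesis
    using cross_sign_swap[of "J - A" A] assms by (simp add: plucker_term_def)
qed

text \<open>Compares two sign conventions: the sorting signs of the tuples in a bracket, and the
  sign of the shuffle that lists J - A before A. They differ by one sign c common to all summands
  and independent of w.\<close>

lemma signed_exchange_sum:
  fixes I :: "nat set"
  assumes I: "finite I" "I \<inter> set js = {}" and js: "sorted_wrt (<) js"
    and ps: "distinct ps" "set ps \<subseteq> set js"
  defines "is \<equiv> sorted_list_of_set I" and "ts \<equiv> filter (\<lambda>j. j \<notin> set ps) js"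
  shows "\<exists>c\<in>{1, -1}. \<forall>w. (\<Sum>r<length ts. (-1) ^ Suc r *
      (tuple_sign (is @ take r ts @ drop (Suc r) ts) * tuple_sign (is @ ts ! r # ps) *
       (w (set (is @ take r ts @ drop (Suc r) ts)) * w (set (is @ ts ! r # ps)))))
    = c * down (set js) (plucker_term w I (set js)) (set ps)"
proof -
  define J P T L where JPTL: "J = set js" "P = set ps" "T = set ts" "L = length ts"
  have finite: "finite J" "finite P" "finite T" by (simp_all add: JPTL)
  have sorted_ts: "sorted_wrt (<) ts" using js by (simp add: ts_def sorted_wrt_filter)
  then have dist_ts: "distinct ts" by (simp add: strict_sorted_iff)
  have T: "T = J - P" and PJ: "P \<subseteq> J" using ps by (auto simp: JPTL ts_def)
  have "is": "set is = I" "tuple_sign is = 1" "distinct is"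
    using I by (simp_all add: is_def tuple_sign_sorted)
  define e where "e = cross_sign I J"
  have e: "e * e = 1" unfolding e_def JPTL by (rule cross_sign_mult_self) (rule I)
  \<comment> \<open>c gathers what does not depend on r: the inversions between I and J, the sorting
    of \<open>ps\<close>, the inversions between T and P, and the parity of L, which converts that
    of L - Suc r into that of Suc r.\<close>
  define c where "c = e * tuple_sign ps * cross_sign T P * (-1) ^ L"
  have "c * c = 1"
  proof -
    have "c * c = (e * e) * (tuple_sign ps * tuple_sign ps) * (cross_sign T P * cross_sign T P) * ((-1) ^ L * (-1) ^ L)"
      by (simp add: c_def algebra_simps)
    moreover have "(-1::real) ^ L * (-1) ^ L = 1" by (simp flip: power_mult_distrib)
    moreover have "cross_sign T P * cross_sign T P = 1"
      by (rule cross_sign_mult_self) (use T in auto)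
    ultimately show ?thesis using e tuple_sign_mult_self[OF ps(1)] by simp
  qed
  then have c: "c \<in> {1, -1}" by (auto simp: square_eq_1_iff)
  have sign: "(-1) ^ Suc r * (tuple_sign (is @ take r ts @ drop (Suc r) ts) * tuple_sign (is @ ts ! r # ps))
      = c * cross_sign (J - insert (ts ! r) P) (insert (ts ! r) P)"
    and set1: "set (take r ts @ drop (Suc r) ts) = T - {ts ! r}"
    if r: "r < L" for r
  proof -
    define t where "t = ts ! r"
    have ts_eq: "ts = take r ts @ t # drop (Suc r) ts" using r by (simp add: t_def JPTL id_take_nth_drop)
    have ts_sorted: "sorted_wrt (<) (take r ts @ t # drop (Suc r) ts)"
      using sorted_ts by (simp only: ts_eq[symmetric])
    define us where "us = take r ts @ drop (Suc r) ts"
    have sorted_us: "sorted_wrt (<) us" and t_us: "t \<notin> set us"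
      using ts_sorted by (auto simp: us_def sorted_wrt_append)
    have set_ts: "set ts = insert t (set us)"
      using arg_cong[OF ts_eq, of set] by (simp add: us_def)
    have dist_us: "distinct us" using sorted_us by (simp add: strict_sorted_iff)
    have us: "set us = T - {t}" using t_us set_ts by (auto simp: JPTL)
    then show "set (take r ts @ drop (Suc r) ts) = T - {ts ! r}" by (simp add: us_def t_def)
    have tT: "t \<in> T" using set_ts by (simp add: JPTL)
    then have tP: "t \<notin> P" using T by auto
    have "tuple_sign (is @ us) = cross_sign I (T - {t})"
      using dist_us "is" sorted_us us by (simp add: tuple_sign_append tuple_sign_sorted)
    moreover have "tuple_sign (is @ t # ps) = cross_sign I (insert t P) * (cross_sign {t} P * tuple_sign ps)"
    proof -
      have "tuple_sign (is @ t # ps) = tuple_sign is * cross_sign (set is) (set (t # ps)) * tuple_sign (t # ps)"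
        by (rule tuple_sign_append) (use "is"(3) ps(1) tP JPTL(2) in simp_all)
      then show ?thesis
        unfolding tuple_sign_Cons[OF ps(1)] "is"(1,2) list.set(2) JPTL(2) by simp
    qed
    moreover have "e = cross_sign I (T - {t}) * cross_sign I (insert t P)"
    proof -
      have "J = (T - {t}) \<union> insert t P" using T PJ tT by auto
      moreover have "cross_sign I ((T - {t}) \<union> insert t P) = cross_sign I (T - {t}) * cross_sign I (insert t P)"
        by (rule cross_sign_Un_right) (use finite T in auto)
      ultimately show ?thesis by (simp add: e_def)
    qed
    ultimately have prod: "tuple_sign (is @ us) * tuple_sign (is @ t # ps) = e * (cross_sign {t} P * tuple_sign ps)"
      by simp
    \<comment> \<open>Only the entries of \<open>ts\<close> behind t contribute -1, and there are L
      - Suc r of them.\<close>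
    have "cross_sign (T - {t}) {t} = (-1) ^ (L - Suc r)"
    proof -
      have "cross_sign (T - {t}) {t} = (\<Prod>x\<in>set us. sgn (real t - real x))"
        by (simp add: cross_sign_def us)
      also have "\<dots> = (\<Prod>x\<leftarrow>us. sgn (real t - real x))"
        using dist_us by (simp add: prod.distinct_set_conv_list)
      also have "\<dots> = (\<Prod>x\<leftarrow>take r ts. 1) * (\<Prod>x\<leftarrow>drop (Suc r) ts. - 1)"
      proof -
        have "x < t" if "x \<in> set (take r ts)" for x
          using ts_sorted that by (auto simp: sorted_wrt_append)
        moreover have "t < x" if "x \<in> set (drop (Suc r) ts)" for x
          using ts_sorted that by (auto simp: sorted_wrt_append)
        ultimately show ?thesis
          unfolding us_def map_append prod_list.append
          by (intro arg_cong2[of _ _ _ _ "(*)"] arg_cong[of _ _ prod_list] map_cong refl) auto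
      qed
      also have "\<dots> = (-1) ^ (L - Suc r)"
        by (simp add: map_replicate_const prod_list_replicate JPTL)
      finally show ?thesis .
    qed
    moreover have "J - insert t P = T - {t}" using T by auto
    moreover have "cross_sign (T - {t}) (insert t P) = cross_sign (T - {t}) {t} * cross_sign (T - {t}) P"
      using cross_sign_Un_right[of "{t}" P] finite tP by simp
    moreover have "cross_sign T P = cross_sign {t} P * cross_sign (T - {t}) P"
      using cross_sign_insert_left[of "T - {t}" t P] finite tT by (simp add: insert_absorb)
    moreover have "cross_sign (T - {t}) P * cross_sign (T - {t}) P = 1"
      by (rule cross_sign_mult_self) (use T in auto)
    moreover have "(-1::real) ^ L * (-1) ^ (L - Suc r) = (-1) ^ Suc r"
    proof -
      have "L + (L - Suc r) = Suc r + 2 * (L - Suc r)" using r by auto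
      then show ?thesis by (simp only: power_add[symmetric]) (simp add: power_add power_mult)
    qed
    ultimately have yy: "cross_sign (T - {t}) P * cross_sign (T - {t}) P = 1"
      and ll: "(-1::real) ^ L * (-1) ^ (L - Suc r) = (-1) ^ Suc r"
      and eq: "c * cross_sign (J - insert t P) (insert t P)
        = (e * tuple_sign ps * (cross_sign {t} P * cross_sign (T - {t}) P) * (-1) ^ L) *
          ((-1) ^ (L - Suc r) * cross_sign (T - {t}) P)"
      by (simp_all only: c_def)
    note eq
    also have "\<dots> = (e * tuple_sign ps * cross_sign {t} P) *
        (cross_sign (T - {t}) P * cross_sign (T - {t}) P) * ((-1) ^ L * (-1) ^ (L - Suc r))"
      by (simp only: ac_simps)
    also have "\<dots> = (-1) ^ Suc r * (tuple_sign (is @ us) * tuple_sign (is @ t # ps))"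
      unfolding yy ll prod by (simp only: ac_simps mult_1_right mult_1_left)
    finally show "(-1) ^ Suc r * (tuple_sign (is @ take r ts @ drop (Suc r) ts) * tuple_sign (is @ ts ! r # ps))
      = c * cross_sign (J - insert (ts ! r) P) (insert (ts ! r) P)"
      unfolding us_def t_def by simp
  qed
  have factor: "a * (b * (x * y)) = c' * (d * (y * x))" if "a * b = c' * d" for a b c' d x y :: real
  proof -
    have "a * (b * (x * y)) = (a * b) * (y * x)" by (simp only: ac_simps)
    then show ?thesis by (simp only: that mult.assoc)
  qed
  have "(\<Sum>r<L. (-1) ^ Suc r *
      (tuple_sign (is @ take r ts @ drop (Suc r) ts) * tuple_sign (is @ ts ! r # ps) *
       (w (set (is @ take r ts @ drop (Suc r) ts)) * w (set (is @ ts ! r # ps)))))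
    = c * down J (plucker_term w I J) P" for w
  proof -
    have "(\<Sum>r<L. (-1) ^ Suc r *
      (tuple_sign (is @ take r ts @ drop (Suc r) ts) * tuple_sign (is @ ts ! r # ps) *
       (w (set (is @ take r ts @ drop (Suc r) ts)) * w (set (is @ ts ! r # ps)))))
      = (\<Sum>r<L. c * plucker_term w I J (insert (ts ! r) P))"
    proof (rule sum.cong[OF refl])
      fix r assume "r \<in> {..<L}"
      then have r: "r < L" by simp
      have "set (is @ take r ts @ drop (Suc r) ts) = I \<union> (J - insert (ts ! r) P)"
        using set1[OF r] "is"(1) T by auto
      moreover have "set (is @ ts ! r # ps) = I \<union> insert (ts ! r) P" using "is"(1) by (simp add: JPTL)
      ultimately show "(-1) ^ Suc r *
          (tuple_sign (is @ take r ts @ drop (Suc r) ts) * tuple_sign (is @ ts ! r # ps) *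
           (w (set (is @ take r ts @ drop (Suc r) ts)) * w (set (is @ ts ! r # ps))))
        = c * plucker_term w I J (insert (ts ! r) P)"
        using factor[OF sign[OF r]] by (simp only: plucker_term_def)
    qed
    also have "\<dots> = c * (\<Sum>r<L. plucker_term w I J (insert (ts ! r) P))" by (simp add: sum_distrib_left)
    also have "(\<Sum>r<L. plucker_term w I J (insert (ts ! r) P)) = (\<Sum>t\<in>T. plucker_term w I J (insert t P))"
      by (rule sum.reindex_bij_betw[of "(!) ts"]) (use dist_ts in \<open>simp add: JPTL bij_betw_nth\<close>)
    finally show ?thesis by (simp add: down_def T)
  qed
  then show ?thesis using c unfolding JPTL by blast
qed

text \<open>These are the exchange relations between the (k-1)-set I \<union> P and the (k+1)-set I
  \<union> (J - P), sorted by their intersection I. For s = 1 the two terms of the sum would cancel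
  identically by \<open>plucker_term_compl\<close>, hence the range starts at 2.\<close>

definition plucker_relations :: "nat \<Rightarrow> nat \<Rightarrow> (nat set \<Rightarrow> real) \<Rightarrow> bool" where
  "plucker_relations n k w \<longleftrightarrow>
     (\<forall>s I J P. 2 \<le> s \<and> s \<le> k \<and> I \<subseteq> {1..n} \<and> card I = k - s \<and> J \<subseteq> {1..n} - I \<and> card J = 2 * s \<and>
        P \<subseteq> J \<and> Suc (card P) = s \<longrightarrow> down J (plucker_term w I J) P = 0)"

lemma sort_in_multi_indices:
  assumes "length \<alpha> = k" "distinct \<alpha>" "set \<alpha> \<subseteq> {1..n}"
  shows "sort \<alpha> \<in> multi_indices n k"
  using assms by (simp add: multi_indices_def strict_sorted_iff)

lemma extend_coeff_sort:
  assumes "distinct \<alpha>" "distinct \<beta>"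
  shows "extend_coeff q \<alpha> \<beta> = tuple_sign \<alpha> * tuple_sign \<beta> * extend_coeff q (sort \<alpha>) (sort \<beta>)"
  using assms by (simp add: extend_coeff_def tuple_sign_sorted strict_sorted_iff sorted_sort_id)

text \<open>In each term t_r lies in exactly one of the two arguments of q, so only off-diagonal
  coefficients occur and the uniform factor \<open>2 * \<epsilon>\<close> comes out.\<close>

lemma bracket_eq_down:
  assumes q: "\<And>\<alpha> \<beta>. \<alpha> \<in> multi_indices n k \<Longrightarrow> \<beta> \<in> multi_indices n k \<Longrightarrow> \<alpha> \<noteq> \<beta> \<Longrightarrow>
      extend_coeff q \<alpha> \<beta> = 2 * \<epsilon> * (w (set \<alpha>) * w (set \<beta>))"
    and I: "I \<subseteq> {1..n}" "card I = k - s" and s: "s \<le> k"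
    and js: "length js = 2 * s" "sorted_wrt (<) js" "set js \<subseteq> {1..n} - I"
    and ps: "distinct ps" "set ps \<subseteq> set js" "Suc (length ps) = s"
  shows "\<exists>c\<in>{1, -1}. bracket q I js ps = 2 * \<epsilon> * c * down (set js) (plucker_term w I (set js)) (set ps)"
proof -
  define "is" ts where "is = sorted_list_of_set I" and "ts = filter (\<lambda>j. j \<notin> set ps) js"
  have finI: "finite I" using I finite_subset by auto
  have IJ: "I \<inter> set js = {}" using js by auto
  have "is": "set is = I" "distinct is" "length is = k - s"
    using finI I by (simp_all add: is_def)
  have dist_js: "distinct js" using js by (simp add: strict_sorted_iff)
  then have dist_ts: "distinct ts" by (simp add: ts_def)
  have set_ts: "set ts = set js - set ps" by (auto simp: ts_def)
  have length_ts: "length ts = Suc s"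
  proof -
    have "length ts = card (set js - set ps)" using dist_ts set_ts by (metis distinct_card)
    also have "\<dots> = length js - length ps"
      using ps dist_js by (subst card_Diff_subset) (simp_all add: distinct_card)
    finally show ?thesis using js ps by simp
  qed
  obtain c where c: "c \<in> {1, -1::real}" and sum: "(\<Sum>r<length ts. (-1) ^ Suc r *
      (tuple_sign (is @ take r ts @ drop (Suc r) ts) * tuple_sign (is @ ts ! r # ps) *
       (w (set (is @ take r ts @ drop (Suc r) ts)) * w (set (is @ ts ! r # ps)))))
    = c * down (set js) (plucker_term w I (set js)) (set ps)"
    using signed_exchange_sum[OF finI IJ js(2) ps(1,2)] unfolding is_def ts_def by blast
  have "bracket q I js ps = (\<Sum>r<length ts. 2 * \<epsilon> * ((-1) ^ Suc r *
      (tuple_sign (is @ take r ts @ drop (Suc r) ts) * tuple_sign (is @ ts ! r # ps) *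
       (w (set (is @ take r ts @ drop (Suc r) ts)) * w (set (is @ ts ! r # ps))))))"
    unfolding bracket_def Let_def ts_def[symmetric] is_def[symmetric]
  proof (rule sum.cong[OF refl])
    fix r assume "r \<in> {..<length ts}"
    then have r: "r < length ts" by simp
    define us where "us = take r ts @ drop (Suc r) ts"
    have ts_eq: "ts = take r ts @ ts ! r # drop (Suc r) ts" using r by (simp add: id_take_nth_drop)
    have "distinct (take r ts @ ts ! r # drop (Suc r) ts)" using dist_ts ts_eq by simp
    then have dist_us: "distinct us" and t_us: "ts ! r \<notin> set us" by (auto simp: us_def)
    have sub_us: "set us \<subseteq> set ts" unfolding us_def by (auto dest: in_set_takeD in_set_dropD)
    have t: "ts ! r \<in> set ts" using r by simp
    have l_us: "length us = s" using r length_ts by (simp add: us_def)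
    have \<alpha>: "distinct (is @ us)" "length (is @ us) = k" "set (is @ us) \<subseteq> {1..n}"
      using "is" dist_us sub_us set_ts IJ l_us s I js by auto
    have \<beta>: "distinct (is @ ts ! r # ps)" "length (is @ ts ! r # ps) = k" "set (is @ ts ! r # ps) \<subseteq> {1..n}"
      using "is" ps t set_ts IJ s I js by auto
    have ne: "sort (is @ us) \<noteq> sort (is @ ts ! r # ps)"
    proof
      assume "sort (is @ us) = sort (is @ ts ! r # ps)"
      then have "set (is @ us) = set (is @ ts ! r # ps)" by (metis set_sort)
      then have "ts ! r \<in> I \<union> set us" using "is" by auto
      then show False using t_us t set_ts IJ by auto
    qed
    have "extend_coeff q (is @ us) (is @ ts ! r # ps)
        = tuple_sign (is @ us) * tuple_sign (is @ ts ! r # ps) *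
          (2 * \<epsilon> * (w (set (is @ us)) * w (set (is @ ts ! r # ps))))"
      using q[OF sort_in_multi_indices[OF \<alpha>(2,1,3)] sort_in_multi_indices[OF \<beta>(2,1,3)] ne]
      by (simp only: extend_coeff_sort[OF \<alpha>(1) \<beta>(1)] set_sort)
    then show "(-1) ^ Suc r * extend_coeff q (is @ take r ts @ drop (Suc r) ts) (is @ ts ! r # ps)
        = 2 * \<epsilon> * ((-1) ^ Suc r *
      (tuple_sign (is @ take r ts @ drop (Suc r) ts) * tuple_sign (is @ ts ! r # ps) *
       (w (set (is @ take r ts @ drop (Suc r) ts)) * w (set (is @ ts ! r # ps)))))"
      unfolding us_def[symmetric] by (simp only: mult_ac)
  qed
  also have "\<dots> = 2 * \<epsilon> * (c * down (set js) (plucker_term w I (set js)) (set ps))"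
    by (simp only: sum_distrib_left[symmetric] sum)
  finally show ?thesis using c by (auto simp: mult.assoc)
qed

lemma plucker_imp_linear_relations:
  assumes q: "\<And>\<alpha> \<beta>. \<alpha> \<in> multi_indices n k \<Longrightarrow> \<beta> \<in> multi_indices n k \<Longrightarrow> \<alpha> \<noteq> \<beta> \<Longrightarrow>
      extend_coeff q \<alpha> \<beta> = 2 * \<epsilon> * (w (set \<alpha>) * w (set \<beta>))"
    and w: "plucker_relations n k w"
  shows "linear_relations n k q"
proof -
  have zero: "bracket q I js ps = 0"
    if "2 \<le> s" "s \<le> k" "I \<subseteq> {1..n}" "card I = k - s" "length js = 2 * s" "sorted_wrt (<) js"
      "set js \<subseteq> {1..n} - I" "distinct ps" "set ps \<subseteq> set js" "Suc (length ps) = s" for s I js ps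
  proof -
    have "card (set js) = 2 * s" using that by (metis distinct_card strict_sorted_iff)
    then have "down (set js) (plucker_term w I (set js)) (set ps) = 0"
      using w that distinct_card[of ps] unfolding plucker_relations_def by metis
    then show ?thesis using bracket_eq_down[OF q that(3,4,2,5-10)] by auto
  qed
  show ?thesis
    unfolding linear_relations_def
  proof (intro allI impI, elim conjE, intro conjI allI impI; elim conjE)
    fix s I and js :: "nat list"
    assume s: "2 \<le> s" "s \<le> k" "I \<subseteq> {1..n}" "card I = k - s" "length js = 2 * s" "sorted_wrt (<) js"
      "set js \<subseteq> {1..n} - I"
    obtain j0 j1 j2 js' where js: "js = j0 # j1 # j2 # js'"
      using s(1,5) by (cases js; cases "tl js"; cases "tl (tl js)") auto
    have nth: "js ! 0 = j0" "js ! 1 = j1" "js ! 2 = j2" "drop 2 js = j2 # js'" "drop 3 js = js'"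
      by (simp_all add: js numeral_3_eq_3)
    have ord: "j0 < j1" "j1 < j2" "\<forall>j\<in>set js'. j2 < j" using s(6) js by auto
    then have notin: "j0 \<notin> insert j2 (set js')" "j1 \<notin> insert j2 (set js')" "j2 \<notin> set js'" by auto
    show "bracket q I js (js ! 0 # js ! 1 # ls) = 0"
      if ls: "3 \<le> s" "length ls = s - 3" "sorted_wrt (<) ls" "set ls \<subseteq> set (drop 2 js)" for ls
    proof -
      have "j0 \<notin> set ls" "j1 \<notin> set ls" using ls(4) notin unfolding nth by auto
      then show ?thesis
        unfolding nth by (intro zero[OF s]) (use ls ord in \<open>auto simp: js nth strict_sorted_iff\<close>)
    qed
    show "bracket q I js (js ! 0 # js ! 2 # ls) = 0"
      if ls: "3 \<le> s" "length ls = s - 3" "sorted_wrt (<) ls" "set ls \<subseteq> set (drop 3 js)" for ls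
    proof -
      have "j0 \<notin> set ls" "j2 \<notin> set ls" using ls(4) notin unfolding nth by auto
      then show ?thesis
        unfolding nth by (intro zero[OF s]) (use ls ord in \<open>auto simp: js nth strict_sorted_iff\<close>)
    qed
    show "bracket q I js (js ! 1 # ls) = 0"
      if ls: "length ls = s - 2" "sorted_wrt (<) ls" "set ls \<subseteq> set (drop 3 js)" for ls
    proof -
      have "j1 \<notin> set ls" using ls(3) notin unfolding nth by auto
      then show ?thesis
        unfolding nth by (intro zero[OF s]) (use ls ord s(1) in \<open>auto simp: js nth strict_sorted_iff\<close>)
    qed
  qed
qed

text \<open>The sum over sets forgets the order of P, so each hypothesis of
  \<open>down_vanishes\<close> is supplied by the tuple that puts the distinguished elements at the
  front and the rest in increasing order. In the first family the rest may contain j_3; in the other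
  two it avoids all three distinguished elements.\<close>

lemma linear_relations_imp_plucker:
  assumes q: "\<And>\<alpha> \<beta>. \<alpha> \<in> multi_indices n k \<Longrightarrow> \<beta> \<in> multi_indices n k \<Longrightarrow> \<alpha> \<noteq> \<beta> \<Longrightarrow>
      extend_coeff q \<alpha> \<beta> = 2 * \<epsilon> * (w (set \<alpha>) * w (set \<beta>))"
    and \<epsilon>: "\<epsilon> \<noteq> 0" and lin: "linear_relations n k q"
  shows "plucker_relations n k w"
  unfolding plucker_relations_def
proof (intro allI impI, elim conjE)
  fix s :: nat and I J P :: "nat set"
  assume s: "2 \<le> s" "s \<le> k" "I \<subseteq> {1..n}" "card I = k - s"
    and J: "J \<subseteq> {1..n} - I" "card J = 2 * s" and P: "P \<subseteq> J" "Suc (card P) = s"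
  have finJ: "finite J" using J finite_subset by auto
  define js where "js = sorted_list_of_set J"
  have js: "length js = 2 * s" "sorted_wrt (<) js" "set js = J"
    using finJ J by (simp_all add: js_def)
  \<comment> \<open>In the numbering of the theorem these are j_1, j_2, j_3; they exist because J
    has at least four elements.\<close>
  obtain j0 j1 j2 js' where js_eq: "js = j0 # j1 # j2 # js'"
    using s(1) js(1) by (cases js; cases "tl js"; cases "tl (tl js)") auto
  have ord: "j0 < j1" "j1 < j2" "\<forall>j\<in>set js'. j2 < j" using js(2) js_eq by auto
  have J_eq: "J = {j0, j1, j2} \<union> set js'" using js(3) js_eq by auto
  have nth: "js ! 0 = j0" "js ! 1 = j1" "js ! 2 = j2" "drop 2 js = j2 # js'" "drop 3 js = js'"
    by (simp_all add: js_eq numeral_3_eq_3)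
  have down_zero: "down J (plucker_term w I J) (set ps) = 0"
    if "bracket q I js ps = 0" "distinct ps" "set ps \<subseteq> J" "Suc (length ps) = s" for ps
    using bracket_eq_down[OF q s(3,4,2) js(1,2) _ that(2) _ that(4)] that(1,3) \<epsilon> js(3) J(1) by auto
  have lin1: "bracket q I js (j0 # j1 # ls) = 0"
    if "3 \<le> s" "length ls = s - 3" "sorted_wrt (<) ls" "set ls \<subseteq> insert j2 (set js')" for ls
    using lin[unfolded linear_relations_def, rule_format, of s I js] s js J that nth by auto
  have lin2: "bracket q I js (j0 # j2 # ls) = 0"
    if "3 \<le> s" "length ls = s - 3" "sorted_wrt (<) ls" "set ls \<subseteq> set js'" for ls
    using lin[unfolded linear_relations_def, rule_format, of s I js] s js J that nth by auto
  have lin3: "bracket q I js (j1 # ls) = 0"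
    if "length ls = s - 2" "sorted_wrt (<) ls" "set ls \<subseteq> set js'" for ls
    using lin[unfolded linear_relations_def, rule_format, of s I js] s js J that nth by auto
  have sl: "length (sorted_list_of_set Q) = card Q" "sorted_wrt (<) (sorted_list_of_set Q)"
    "set (sorted_list_of_set Q) = Q" "distinct (sorted_list_of_set Q)" if "Q \<subseteq> J" for Q
    using finite_subset[OF that finJ] by simp_all
  show "down J (plucker_term w I J) P = 0"
  proof (rule down_vanishes[OF finJ J(2) s(1), of j0 j1 j2])
    fix A assume "A \<subseteq> J" "card A = s"
    then show "plucker_term w I J (J - A) = (-1) ^ s * plucker_term w I J A"
      by (rule plucker_term_compl[OF finJ J(2)])
  next
    fix Q assume Q: "Q \<subseteq> J" "Suc (card Q) = s" "j0 \<in> Q" "j1 \<in> Q"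
    define R where "R = Q - {j0, j1}"
    have R: "R \<subseteq> J" and finR: "finite R" and Q_eq: "Q = insert j0 (insert j1 R)" "j0 \<notin> R" "j1 \<notin> R"
      using Q finite_subset[OF Q(1) finJ] by (auto simp: R_def)
    have "card R + 3 = s" using Q(2) finR Q_eq ord by simp
    moreover have "R \<subseteq> insert j2 (set js')" using R Q_eq unfolding J_eq by blast
    ultimately show "down J (plucker_term w I J) Q = 0"
      using down_zero[OF lin1[of "sorted_list_of_set R"]] sl[OF R] Q_eq Q(1) ord by simp
  next
    fix Q assume Q: "Q \<subseteq> J" "Suc (card Q) = s" "j0 \<in> Q" "j2 \<in> Q" "j1 \<notin> Q"
    define R where "R = Q - {j0, j2}"
    have R: "R \<subseteq> J" and finR: "finite R" and Q_eq: "Q = insert j0 (insert j2 R)" "j0 \<notin> R" "j2 \<notin> R" "j1 \<notin> R"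
      using Q finite_subset[OF Q(1) finJ] by (auto simp: R_def)
    have "card R + 3 = s" using Q(2) finR Q_eq ord by simp
    moreover have "R \<subseteq> set js'" using R Q_eq unfolding J_eq by blast
    ultimately show "down J (plucker_term w I J) Q = 0"
      using down_zero[OF lin2[of "sorted_list_of_set R"]] sl[OF R] Q_eq Q(1) ord by simp
  next
    fix Q assume Q: "Q \<subseteq> J" "Suc (card Q) = s" "j1 \<in> Q" "j0 \<notin> Q" "j2 \<notin> Q"
    define R where "R = Q - {j1}"
    have R: "R \<subseteq> J" and finR: "finite R" and Q_eq: "Q = insert j1 R" "j0 \<notin> R" "j2 \<notin> R" "j1 \<notin> R"
      using Q finite_subset[OF Q(1) finJ] by (auto simp: R_def)
    have "card R + 2 = s" using Q(2) finR Q_eq ord by simp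
    moreover have "R \<subseteq> set js'" using R Q_eq unfolding J_eq by blast
    ultimately show "down J (plucker_term w I J) Q = 0"
      using down_zero[OF lin3[of "sorted_list_of_set R"]] sl[OF R] Q_eq Q(1) ord by simp
  qed (use P ord J_eq in auto)
qed

text \<open>Induction on the number of entries of \<alpha> outside \<open>\<alpha>\<^sub>0\<close>.
  From two on, a suitable exchange relation can be solved for \<open>w \<alpha>\<close>, whose
  coefficient there is \<open>w \<alpha>\<^sub>0\<close> up to sign.\<close>

lemma plucker_determined:
  assumes w: "plucker_relations n k w" and w': "plucker_relations n k w'"
    and \<alpha>\<^sub>0: "\<alpha>\<^sub>0 \<subseteq> {1..n}" "card \<alpha>\<^sub>0 = k" "w \<alpha>\<^sub>0 \<noteq> 0" "w' \<alpha>\<^sub>0 = w \<alpha>\<^sub>0"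
    and nbr: "\<And>i j. i \<in> \<alpha>\<^sub>0 \<Longrightarrow> j \<in> {1..n} - \<alpha>\<^sub>0 \<Longrightarrow> w' (insert j (\<alpha>\<^sub>0 - {i})) = w (insert j (\<alpha>\<^sub>0 - {i}))"
    and \<alpha>: "\<alpha> \<subseteq> {1..n}" "card \<alpha> = k"
  shows "w' \<alpha> = w \<alpha>"
  using \<alpha>
proof (induction "card (\<alpha> - \<alpha>\<^sub>0)" arbitrary: \<alpha> rule: less_induct)
  case less
  define I A B s where "I = \<alpha> \<inter> \<alpha>\<^sub>0" "A = \<alpha> - \<alpha>\<^sub>0" "B = \<alpha>\<^sub>0 - \<alpha>" "s = card A"
  note defs = this
  have fin: "finite \<alpha>" "finite \<alpha>\<^sub>0" "finite I" "finite A" "finite B"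
    using less.prems \<alpha>\<^sub>0 finite_subset[of _ "{1..n}"] by (auto simp: defs)
  have \<alpha>_eq: "\<alpha> = I \<union> A" "\<alpha>\<^sub>0 = I \<union> B" and disj: "I \<inter> A = {}" "I \<inter> B = {}" "A \<inter> B = {}"
    by (auto simp: defs)
  have cards: "card I + card A = k" "card I + card B = k"
    using less.prems(2) \<alpha>\<^sub>0(2) fin disj \<alpha>_eq by (metis card_Un_disjoint)+
  consider "s = 0" | "s = 1" | "2 \<le> s" by linarith
  then show ?case
  proof cases
    case 1
    then have "card A = 0" "card B = 0" using cards defs(4) by auto
    then have "A = {}" "B = {}" using fin by simp_all
    then show ?thesis using \<alpha>\<^sub>0(4) \<alpha>_eq by simp
  next
    case 2
    then have "card A = 1" "card B = 1" using cards defs(4) by auto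
    then obtain j i where ji: "A = {j}" "B = {i}" by (auto simp: card_1_singleton_iff)
    have "i \<in> \<alpha>\<^sub>0" "j \<in> {1..n} - \<alpha>\<^sub>0" "\<alpha> = insert j (\<alpha>\<^sub>0 - {i})"
      using ji less.prems by (auto simp: defs)
    then show ?thesis using nbr by metis
  next
    case 3
    \<comment> \<open>J is the symmetric difference of \<alpha> and \<open>\<alpha>\<^sub>0\<close>,
      and P omits one element t0 of A. Inserting t0 gives the pair \<alpha>,
      \<open>\<alpha>\<^sub>0\<close>; inserting t from B gives sets with s - 1 and with 1 element
      outside \<open>\<alpha>\<^sub>0\<close>, both covered by the induction.\<close>
    define J where "J = A \<union> B"
    obtain t0 where t0: "t0 \<in> A" using 3 defs(4) by fastforce
    define P where "P = A - {t0}"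
    have A_eq: "A = insert t0 P" and t0P: "t0 \<notin> P" using t0 by (auto simp: P_def)
    have cardP: "Suc (card P) = s" using card_Suc_Diff1[OF fin(4) t0] by (simp only: P_def defs(4))
    have sub: "I \<subseteq> {1..n}" "A \<subseteq> {1..n}" "B \<subseteq> {1..n}" using less.prems(1) \<alpha>\<^sub>0(1) by (auto simp: defs(1-3))
    have "card J = card A + card B" unfolding J_def by (rule card_Un_disjoint) (fact fin disj)+
    then have s: "s \<le> k" "card I = k - s" "card J = 2 * s" "I \<subseteq> {1..n}" "J \<subseteq> {1..n} - I" "P \<subseteq> J"
      using cards defs(4) sub disj by (auto simp: J_def P_def)
    have zero: "down J (plucker_term v I J) P = 0" if "plucker_relations n k v" for v
      using that 3 s cardP unfolding plucker_relations_def by metis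
    have JP: "J - P = insert t0 B" "t0 \<notin> B" using A_eq t0P disj by (auto simp: J_def)
    have JA: "J - insert t0 P = B" using A_eq disj by (auto simp: J_def)
    have first: "plucker_term v I J (insert t0 P) = cross_sign B A * (v \<alpha> * v \<alpha>\<^sub>0)" for v
      by (simp only: plucker_term_def JA) (simp only: A_eq[symmetric] \<alpha>_eq[symmetric])
    have split: "cross_sign B A * (v \<alpha> * v \<alpha>\<^sub>0) + (\<Sum>t\<in>B. plucker_term v I J (insert t P)) = 0"
      if "plucker_relations n k v" for v
    proof -
      have "down J (plucker_term v I J) P
          = plucker_term v I J (insert t0 P) + (\<Sum>t\<in>B. plucker_term v I J (insert t P))"
        unfolding down_def JP(1) by (rule sum.insert) (fact fin JP)+
      then show ?thesis using zero[OF that] first by simp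
    qed
    have "plucker_term w' I J (insert t P) = plucker_term w I J (insert t P)" if t: "t \<in> B" for t
    proof -
      define \<beta> \<gamma> where "\<beta> = I \<union> insert t P" "\<gamma> = I \<union> (J - insert t P)"
      have tP: "t \<notin> P" "t \<notin> A" "t \<notin> I" using t disj by (auto simp: P_def)
      have \<gamma>: "\<gamma> = I \<union> insert t0 (B - {t})" using JP tP t A_eq by (auto simp: \<beta>_\<gamma>_def J_def)
      have "card \<beta> = k"
        using cards(1) cardP tP(1) fin disj t defs(4)
        by (subst \<beta>_\<gamma>_def, subst card_Un_disjoint) (auto simp: P_def)
      moreover have "card \<gamma> = k"
      proof -
        have "card (insert t0 (B - {t})) = card B"
          using card_Suc_Diff1[OF fin(5) t] fin(5) JP(2) by (simp del: card_Diff_singleton card_Diff_insert)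
        then show ?thesis
          unfolding \<gamma> using cards(2) fin disj t0 by (subst card_Un_disjoint) auto
      qed
      moreover have "\<beta> \<subseteq> {1..n}" "\<gamma> \<subseteq> {1..n}"
        using less.prems \<alpha>\<^sub>0(1) t t0 unfolding \<beta>_\<gamma>_def(1) \<gamma> \<alpha>_eq P_def by auto
      moreover have "\<beta> - \<alpha>\<^sub>0 = P" "\<gamma> - \<alpha>\<^sub>0 = {t0}"
        using disj t t0 unfolding \<beta>_\<gamma>_def(1) \<gamma> \<alpha>_eq P_def by auto
      moreover have "card P < s" "card {t0} < s" using cardP 3 by auto
      ultimately have "w' \<beta> = w \<beta>" "w' \<gamma> = w \<gamma>"
        using less.hyps[of \<beta>] less.hyps[of \<gamma>] by (simp_all add: defs(2,4))
      then show ?thesis by (simp add: plucker_term_def \<beta>_\<gamma>_def)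
    qed
    then have "(\<Sum>t\<in>B. plucker_term w' I J (insert t P)) = (\<Sum>t\<in>B. plucker_term w I J (insert t P))"
      by simp
    then have "cross_sign B A * (w' \<alpha> * w \<alpha>\<^sub>0) = cross_sign B A * (w \<alpha> * w \<alpha>\<^sub>0)"
      using split[OF w] split[OF w'] unfolding \<alpha>\<^sub>0(4) by linarith
    moreover have "cross_sign B A \<noteq> 0"
      using cross_sign_mult_self[of B A] disj(3) by (auto simp: Int_commute)
    ultimately show ?thesis using \<alpha>\<^sub>0(3) by simp
  qed
qed

section \<open>Minors\<close>

text \<open>Columns are selected by a tuple, in its order and with repetitions, so that
  \<open>minor k a\<close> is alternating in the tuple. The value 0 at other lengths extends this to
  all lists, the form in which \<open>alternating_sort\<close> is stated.\<close>

definition minor :: "nat \<Rightarrow> (nat \<Rightarrow> nat \<Rightarrow> real) \<Rightarrow> nat list \<Rightarrow> real" where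
  "minor k a ts = (if length ts = k then Determinant.det (Matrix.mat k k (\<lambda>(i, j). a i (ts ! j))) else 0)"

lemma minor_cong:
  assumes "\<And>i j. i < k \<Longrightarrow> j \<in> set ts \<Longrightarrow> a i j = b i j"
  shows "minor k a ts = minor k b ts"
  unfolding minor_def
  by (auto intro!: arg_cong[of _ _ Determinant.det] cong_mat simp: assms)

text \<open>The cofactors along row i do not involve row i, so one family of coefficients serves all
  x; additivity and homogeneity in the row both follow.\<close>

lemma minor_expand_row:
  assumes "i < k"
  shows "\<exists>C. \<forall>x. minor k (a(i := x)) ts = (\<Sum>j<k. x (ts ! j) * C j)"
proof (cases "length ts = k")
  case True
  let ?M = "\<lambda>x. Matrix.mat k k (\<lambda>(i', j). (a(i := x)) i' (ts ! j))"
  have "mat_delete (?M x) i j = mat_delete (?M y) i j" for x y j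
    unfolding mat_delete_def by (rule cong_mat) auto
  then have cof: "cofactor (?M x) i j = cofactor (?M (\<lambda>_. 0)) i j" for x j
    unfolding cofactor_def by metis
  have "minor k (a(i := x)) ts = (\<Sum>j<k. x (ts ! j) * cofactor (?M (\<lambda>_. 0)) i j)" for x
  proof -
    have "Determinant.det (?M x) = (\<Sum>j<k. ?M x $$ (i, j) * cofactor (?M x) i j)"
      by (rule laplace_expansion_row) (use assms in auto)
    also have "\<dots> = (\<Sum>j<k. x (ts ! j) * cofactor (?M (\<lambda>_. 0)) i j)"
    proof (rule sum.cong[OF refl])
      fix j assume "j \<in> {..<k}"
      then have "?M x $$ (i, j) = x (ts ! j)" using assms by simp
      then show "?M x $$ (i, j) * cofactor (?M x) i j = x (ts ! j) * cofactor (?M (\<lambda>_. 0)) i j"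
        by (simp only: cof[of x])
    qed
    finally show ?thesis using True by (simp add: minor_def)
  qed
  then show ?thesis by blast
qed (auto simp: minor_def intro: exI[of _ "\<lambda>_. 0"])

lemma minor_row_add:
  assumes "i < k"
  shows "minor k (a(i := (\<lambda>j. x j + y j))) ts = minor k (a(i := x)) ts + minor k (a(i := y)) ts"
proof -
  obtain C where C: "\<And>x. minor k (a(i := x)) ts = (\<Sum>j<k. x (ts ! j) * C j)"
    using minor_expand_row[OF assms] by blast
  show ?thesis by (simp add: C sum.distrib distrib_right)
qed

lemma minor_row_scale:
  assumes "i < k"
  shows "minor k (a(i := (\<lambda>j. c * x j))) ts = c * minor k (a(i := x)) ts"
proof -
  obtain C where C: "\<And>x. minor k (a(i := x)) ts = (\<Sum>j<k. x (ts ! j) * C j)"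
    using minor_expand_row[OF assms] by blast
  show ?thesis by (simp add: C sum_distrib_left mult.assoc)
qed

lemma minor_identical_rows:
  assumes "i < k" "i' < k" "i \<noteq> i'" "a i = a i'"
  shows "minor k a ts = 0"
proof -
  have "Determinant.det (Matrix.mat k k (\<lambda>(i, j). a i (ts ! j))) = 0"
    by (rule det_identical_rows[OF _ assms(3,1,2)]) (use assms in \<open>auto intro!: eq_vecI\<close>)
  then show ?thesis by (simp add: minor_def)
qed

lemma minor_swap: "minor k a (xs @ x # y # ys) = - minor k a (xs @ y # x # ys)"
proof (cases "length (xs @ x # y # ys) = k")
  case True
  define p where "p = length xs"
  let ?A = "Matrix.mat k k (\<lambda>(i, j). a i ((xs @ x # y # ys) ! j))"
  have p: "p < k" "Suc p < k" using True by (auto simp: p_def)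
  have "Determinant.det (swapcols p (Suc p) ?A) = - Determinant.det ?A"
    by (rule det_swapcols) (use p in auto)
  moreover have "swapcols p (Suc p) ?A = Matrix.mat k k (\<lambda>(i, j). a i ((xs @ y # x # ys) ! j))"
    using p by (intro eq_matI) (auto simp: mat_swapcols_def p_def nth_append nth_Cons' split: if_splits)
  ultimately show ?thesis using True by (simp add: minor_def)
qed (simp add: minor_def)

lemma minor_sort: "minor k a ts = tuple_sign ts * minor k a (sort ts)"
  using alternating_sort[of "minor k a" ts, OF minor_swap] by simp

text \<open>Laplace expansion of the second factor along its first column turns the sum into
  the expansion along the first row of determinants with two equal rows.\<close>

lemma minor_exchange:
  assumes "length T = Suc k" "Suc (length P) = k"
  shows "(\<Sum>r<Suc k. (-1) ^ r * (minor k a (take r T @ drop (Suc r) T) * minor k a (T ! r # P))) = 0"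
proof -
  \<comment> \<open>The column index 0 is a dummy: cofactors along the first column do not see that
    column.\<close>
  define C where "C = (\<lambda>i. cofactor (Matrix.mat k k (\<lambda>(i, j). a i ((0 # P) ! j))) i 0)"
  have k: "0 < k" using assms by auto
  have col: "minor k a (t # P) = (\<Sum>i<k. a i t * C i)" for t
  proof -
    let ?M = "Matrix.mat k k (\<lambda>(i, j). a i ((t # P) ! j))"
    have "minor k a (t # P) = (\<Sum>i<k. ?M $$ (i, 0) * cofactor ?M i 0)"
      using assms k by (simp add: minor_def laplace_expansion_column[of _ k 0])
    also have "\<dots> = (\<Sum>i<k. a i t * C i)"
    proof (rule sum.cong[OF refl])
      fix i assume "i \<in> {..<k}"
      moreover have "mat_delete ?M i 0 = mat_delete (Matrix.mat k k (\<lambda>(i, j). a i ((0 # P) ! j))) i 0"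
        unfolding mat_delete_def by (rule cong_mat) auto
      ultimately show "?M $$ (i, 0) * cofactor ?M i 0 = a i t * C i"
        using k by (simp add: C_def cofactor_def)
    qed
    finally show ?thesis .
  qed
  have row: "(\<Sum>r<Suc k. (-1) ^ r * (minor k a (take r T @ drop (Suc r) T) * a i (T ! r))) = 0" if i: "i < k" for i
  proof -
    define M where "M = Matrix.mat (Suc k) (Suc k) (\<lambda>(i', j). case i' of 0 \<Rightarrow> a i (T ! j) | Suc m \<Rightarrow> a m (T ! j))"
    have "0 = Determinant.det M"
      by (rule det_identical_rows[of M "Suc k" 0 "Suc i", symmetric]) (use i in \<open>auto simp: M_def intro!: eq_vecI\<close>)
    also have "\<dots> = (\<Sum>r<Suc k. M $$ (0, r) * cofactor M 0 r)"
      by (rule laplace_expansion_row) (auto simp: M_def)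
    also have "\<dots> = (\<Sum>r<Suc k. (-1) ^ r * (minor k a (take r T @ drop (Suc r) T) * a i (T ! r)))"
    proof (rule sum.cong[OF refl])
      fix r assume "r \<in> {..<Suc k}"
      then have r: "r < Suc k" by simp
      have "mat_delete M 0 r = Matrix.mat k k (\<lambda>(i, j). a i ((take r T @ drop (Suc r) T) ! j))"
        using r assms(1) by (intro eq_matI) (auto simp: mat_delete_def M_def nth_append)
      then show "M $$ (0, r) * cofactor M 0 r = (-1) ^ r * (minor k a (take r T @ drop (Suc r) T) * a i (T ! r))"
        using r assms(1) by (simp add: cofactor_def minor_def M_def)
    qed
    finally show ?thesis by simp
  qed
  have "(\<Sum>r<Suc k. (-1) ^ r * (minor k a (take r T @ drop (Suc r) T) * minor k a (T ! r # P)))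
      = (\<Sum>r<Suc k. \<Sum>i<k. C i * ((-1) ^ r * (minor k a (take r T @ drop (Suc r) T) * a i (T ! r))))"
    unfolding col sum_distrib_left by (simp only: mult_ac)
  also have "\<dots> = (\<Sum>i<k. \<Sum>r<Suc k. C i * ((-1) ^ r * (minor k a (take r T @ drop (Suc r) T) * a i (T ! r))))"
    by (rule sum.swap)
  also have "\<dots> = 0" unfolding sum_distrib_left[symmetric] by (intro sum.neutral ballI) (simp only: row lessThan_iff mult_zero_right)
  finally show ?thesis .
qed

lemma minor_move_front:
  "minor k a (xs @ t # ys) = (-1) ^ length xs * minor k a (t # xs @ ys)"
proof (induction xs arbitrary: ys rule: rev_induct)
  case (snoc x xs)
  have "minor k a ((xs @ [x]) @ t # ys) = - minor k a (xs @ t # x # ys)"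
    using minor_swap[of k a xs x t ys] by simp
  then show ?case using snoc[of "x # ys"] by simp
qed simp

lemma sum_lessThan_add: "(\<Sum>r<m + n. g r) = (\<Sum>r<m. g r) + (\<Sum>r<n. g (m + r :: nat) :: real)"
  by (induction n) (simp_all add: add.assoc)

lemma tuple_sign_not_distinct: "\<not> distinct xs \<Longrightarrow> tuple_sign xs = 0"
  by (induction xs) (force simp: prod_list_zero_iff)+

text \<open>\<open>minor_exchange\<close> is applied to \<open>is @ ts\<close> and
  \<open>is @ ps\<close>. The summands that move an element of I produce a repeated column and
  vanish; the rest are the terms of \<open>signed_exchange_sum\<close> up to a common sign.\<close>

lemma plucker_relations_minor:
  "plucker_relations n k (\<lambda>S. minor k a (sorted_list_of_set S))"
  unfolding plucker_relations_def
proof (intro allI impI, elim conjE)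
  fix s :: nat and I J P :: "nat set"
  assume s: "2 \<le> s" "s \<le> k" "I \<subseteq> {1..n}" "card I = k - s"
    and J: "J \<subseteq> {1..n} - I" "card J = 2 * s" and P: "P \<subseteq> J" "Suc (card P) = s"
  define w where "w = (\<lambda>S. minor k a (sorted_list_of_set S))"
  define js ps "is" ts where "js = sorted_list_of_set J" "ps = sorted_list_of_set P"
    "is = sorted_list_of_set I" "ts = filter (\<lambda>j. j \<notin> set ps) js"
  note defs = this
  have sub: "I \<subseteq> {1..n}" "J \<subseteq> {1..n}" "P \<subseteq> {1..n}" using s J P by auto
  then have fin: "finite I" "finite J" "finite P" by (auto intro: finite_subset)
  have js: "set js = J" "sorted_wrt (<) js" and ps: "set ps = P" "distinct ps"
    and is_set: "set is = I" "distinct is" "length is = k - s" "length ps = card P"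
    using fin s by (simp_all add: defs)
  have IJ: "I \<inter> set js = {}" using J js by auto
  have set_ts: "set ts = J - P" using js ps by (auto simp: defs(4))
  have dist_ts: "distinct ts" unfolding defs(4) using js by (simp add: strict_sorted_iff)
  have length_ts: "length ts = Suc s"
  proof -
    have "length ts = card (J - P)" using dist_ts set_ts by (metis distinct_card)
    also have "\<dots> = Suc s" using fin J P by (subst card_Diff_subset) auto
    finally show ?thesis .
  qed
  obtain c where c: "c \<in> {1, -1::real}" and sum: "(\<Sum>r<length ts. (-1) ^ Suc r *
      (tuple_sign (is @ take r ts @ drop (Suc r) ts) * tuple_sign (is @ ts ! r # ps) *
       (w (set (is @ take r ts @ drop (Suc r) ts)) * w (set (is @ ts ! r # ps)))))
    = c * down J (plucker_term w I J) P"
    using signed_exchange_sum[OF fin(1) IJ js(2) ps(2)] ps(1) js(1) P(1) unfolding defs(3,4) by metis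
  have w: "tuple_sign xs * w (set xs) = minor k a xs" if "distinct xs" for xs
    using that unfolding w_def
    by (subst (2) minor_sort) (simp add: sorted_list_of_set_sort_remdups distinct_remdups_id)
  define m where "m = length is"
  define g where "g = (\<lambda>r. (-1) ^ r * (minor k a (take r (is @ ts) @ drop (Suc r) (is @ ts)) * minor k a ((is @ ts) ! r # is @ ps)))"
  have km: "Suc k = m + Suc s" using s is_set(3) by (simp add: m_def)
  have "0 = (\<Sum>r<Suc k. g r)"
    unfolding g_def by (rule minor_exchange[symmetric]) (use is_set length_ts s P in auto)
  also have "\<dots> = (\<Sum>r<m. g r) + (\<Sum>r<Suc s. g (m + r))"
    unfolding km by (rule sum_lessThan_add)
  also have "(\<Sum>r<m. g r) = 0"
  proof (intro sum.neutral ballI)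
    fix r assume "r \<in> {..<m}"
    then have "(is @ ts) ! r \<in> set (is @ ps)" by (simp add: m_def nth_append)
    then have "\<not> distinct ((is @ ts) ! r # is @ ps)" by simp
    then have "tuple_sign ((is @ ts) ! r # is @ ps) = 0"
      by (rule tuple_sign_not_distinct)
    then have "minor k a ((is @ ts) ! r # is @ ps) = 0" by (subst minor_sort) simp
    then show "g r = 0" by (simp add: g_def)
  qed
  also have "(\<Sum>r<Suc s. g (m + r)) = (\<Sum>r<length ts. - ((-1) ^ Suc r *
      (tuple_sign (is @ take r ts @ drop (Suc r) ts) * tuple_sign (is @ ts ! r # ps) *
       (w (set (is @ take r ts @ drop (Suc r) ts)) * w (set (is @ ts ! r # ps))))))"
  proof (rule sum.cong)
    fix r assume "r \<in> {..<length ts}"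
    then have r: "r < length ts" by simp
    have ts_eq: "ts = take r ts @ ts ! r # drop (Suc r) ts" using r by (simp add: id_take_nth_drop)
    have t: "ts ! r \<in> set ts" using r by simp
    have "distinct (take r ts @ ts ! r # drop (Suc r) ts)" using dist_ts ts_eq by simp
    then have d1: "distinct (take r ts @ drop (Suc r) ts)" by auto
    have sub: "set (take r ts @ drop (Suc r) ts) \<subseteq> set ts" by (auto dest: in_set_takeD in_set_dropD)
    have d: "distinct (is @ take r ts @ drop (Suc r) ts)"
      using is_set d1 sub set_ts IJ js(1) by (subst distinct_append) auto
    have d': "distinct (is @ ts ! r # ps)"
      using is_set t set_ts IJ js(1) ps P by auto
    have "g (m + r) = (-1) ^ (m + r) * (minor k a (is @ take r ts @ drop (Suc r) ts) * minor k a (ts ! r # is @ ps))"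
      by (simp add: g_def m_def nth_append)
    also have "\<dots> = (-1) ^ r * (minor k a (is @ take r ts @ drop (Suc r) ts) * minor k a (is @ ts ! r # ps))"
      by (simp add: minor_move_front[of k a "is"] m_def power_add)
    also have "\<dots> = (-1) ^ r * ((tuple_sign (is @ take r ts @ drop (Suc r) ts) * w (set (is @ take r ts @ drop (Suc r) ts))) *
       (tuple_sign (is @ ts ! r # ps) * w (set (is @ ts ! r # ps))))"
      by (simp only: w[OF d] w[OF d'])
    finally show "g (m + r) = - ((-1) ^ Suc r *
      (tuple_sign (is @ take r ts @ drop (Suc r) ts) * tuple_sign (is @ ts ! r # ps) *
       (w (set (is @ take r ts @ drop (Suc r) ts)) * w (set (is @ ts ! r # ps)))))"
      by (simp only: power_Suc mult_minus_left mult_1_left minus_minus mult_ac)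
  qed (simp add: length_ts)
  finally have "c * down J (plucker_term w I J) P = 0"
    using sum by (simp add: sum_negf)
  then show "down J (plucker_term (\<lambda>S. minor k a (sorted_list_of_set S)) I J) P = 0"
    using c unfolding w_def by auto
qed

section \<open>Coordinates on the exterior power and its symmetric square\<close>

definition linear_extension :: "('x \<Rightarrow> real) \<Rightarrow> ('x \<Rightarrow>\<^sub>0 real) \<Rightarrow> real" where
  "linear_extension F f = (\<Sum>x\<in>Poly_Mapping.keys f. Poly_Mapping.lookup f x * F x)"

lemma linear_extension_superset:
  assumes "finite S" "Poly_Mapping.keys f \<subseteq> S"
  shows "linear_extension F f = (\<Sum>x\<in>S. Poly_Mapping.lookup f x * F x)"
  unfolding linear_extension_def
  by (rule sum.mono_neutral_left) (use assms in \<open>auto simp: in_keys_iff\<close>)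

lemma lookup_scaleR: "Poly_Mapping.lookup (c *\<^sub>R f) x = c *\<^sub>R Poly_Mapping.lookup f x"
  by (simp add: scaleR_poly_mapping.rep_eq)

lemma linear_linear_extension: "linear (linear_extension F)"
proof (rule linearI)
  fix f g :: "'a \<Rightarrow>\<^sub>0 real"
  let ?S = "Poly_Mapping.keys f \<union> Poly_Mapping.keys g"
  have "Poly_Mapping.keys (f + g) \<subseteq> ?S" by (rule keys_add)
  then show "linear_extension F (f + g) = linear_extension F f + linear_extension F g"
    by (simp add: linear_extension_superset[of ?S] lookup_add distrib_right sum.distrib)
next
  fix c and f :: "'a \<Rightarrow>\<^sub>0 real"
  have "Poly_Mapping.keys (c *\<^sub>R f) \<subseteq> Poly_Mapping.keys f" by (auto simp: in_keys_iff lookup_scaleR)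
  then show "linear_extension F (c *\<^sub>R f) = c *\<^sub>R linear_extension F f"
    by (simp add: linear_extension_superset[of "Poly_Mapping.keys f"] lookup_scaleR sum_distrib_left mult.assoc)
qed

lemma linear_extension_single [simp]: "linear_extension F \<langle>x\<rangle> = F x"
  by (simp add: linear_extension_def)

lemmas linear_extension_simps =
  linear_diff[OF linear_linear_extension] linear_cmul[OF linear_linear_extension]

text \<open>The three clauses mirror the three kinds of generators in \<open>ext_relations\<close>,
  for tuples of every length; a k-form is extended by 0 to the other lengths.\<close>

definition alternating_form :: "('v::real_vector list \<Rightarrow> real) \<Rightarrow> bool" where
  "alternating_form F \<longleftrightarrow>
     (\<forall>xs a b ys. F (xs @ (a + b) # ys) = F (xs @ a # ys) + F (xs @ b # ys)) \<and>
     (\<forall>xs c a ys. F (xs @ (c *\<^sub>R a) # ys) = c * F (xs @ a # ys)) \<and>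
     (\<forall>xs a ys zs. F (xs @ a # ys @ a # zs) = 0)"

text \<open>Evaluation on a chosen representative makes this total in F; that the choice does not
  matter for alternating F is \<open>ext_functional_abs\<close>.\<close>

definition ext_functional :: "('v::real_vector list \<Rightarrow> real) \<Rightarrow> 'v exterior \<Rightarrow> real" where
  "ext_functional F v = linear_extension F (rep_exterior v)"

lemma ext_functional_abs:
  assumes "alternating_form F"
  shows "ext_functional F (abs_exterior f) = linear_extension F f"
proof -
  have "ext_equiv (rep_exterior (abs_exterior f)) f"
    by (rule Quotient_rep_abs[OF Quotient_exterior])
      (simp add: ext_equiv_def span_zero)
  then have "linear_extension F (rep_exterior (abs_exterior f) - f) = 0"
    unfolding ext_equiv_def
  proof (rule linear_eq_0_on_span[OF linear_linear_extension, rotated])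
    fix r assume "r \<in> (ext_relations :: ('a list \<Rightarrow>\<^sub>0 real) set)"
    then show "linear_extension F r = 0"
      using assms unfolding ext_relations_def alternating_form_def
      by (auto simp: linear_extension_simps)
  qed
  then show ?thesis by (simp add: ext_functional_def linear_extension_simps)
qed

lemma ext_functional_linear:
  assumes "alternating_form F"
  shows "linear (ext_functional F)"
proof (rule linearI)
  fix v w :: "'a exterior" and c
  show "ext_functional F (v + w) = ext_functional F v + ext_functional F w"
    by (induction v rule: exterior.abs_induct; induction w rule: exterior.abs_induct)
      (simp add: plus_exterior.abs_eq ext_functional_abs[OF assms] linear_add[OF linear_linear_extension])
  show "ext_functional F (c *\<^sub>R v) = c *\<^sub>R ext_functional F v"
    by (induction v rule: exterior.abs_induct)
      (simp add: scaleR_exterior.abs_eq ext_functional_abs[OF assms] linear_extension_simps)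
qed

lemma ext_functional_wedge: "alternating_form F \<Longrightarrow> ext_functional F (wedge as) = F as"
  by (simp add: wedge.abs_eq ext_functional_abs)

lemma ext_relationsI:
  "\<langle>xs @ (a + b) # ys\<rangle> - \<langle>xs @ a # ys\<rangle> - \<langle>xs @ b # ys\<rangle> \<in> ext_relations"
  "\<langle>xs @ (c *\<^sub>R a) # ys\<rangle> - c *\<^sub>R \<langle>xs @ a # ys\<rangle> \<in> ext_relations"
  "\<langle>xs @ a # ys @ a # zs\<rangle> \<in> ext_relations"
  unfolding ext_relations_def by blast+

lemma wedge_add: "wedge (xs @ (a + b) # ys) = wedge (xs @ a # ys) + wedge (xs @ b # ys)"
  by transfer (unfold ext_equiv_def diff_diff_eq[symmetric], rule span_base, rule ext_relationsI)

lemma wedge_scaleR: "wedge (xs @ (c *\<^sub>R a) # ys) = c *\<^sub>R wedge (xs @ a # ys)"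
  by transfer (unfold ext_equiv_def, rule span_base, rule ext_relationsI)

lemma wedge_repeat: "wedge (xs @ a # ys @ a # zs) = 0"
  by transfer (unfold ext_equiv_def diff_zero, rule span_base, rule ext_relationsI)

lemma wedge_swap: "wedge (xs @ a # b # ys) = - wedge (xs @ b # a # ys)"
proof -
  have rep: "wedge (xs @ c # c # ys) = 0" for c
    using wedge_repeat[of xs c "[]" ys] by simp
  have "0 = wedge (xs @ (a + b) # (a + b) # ys)" by (simp add: rep)
  also have "\<dots> = wedge (xs @ a # (a + b) # ys) + wedge (xs @ b # (a + b) # ys)" by (rule wedge_add)
  also have "\<dots> = wedge (xs @ a # b # ys) + wedge (xs @ b # a # ys)"
    using wedge_add[of "xs @ [a]" a b ys] wedge_add[of "xs @ [b]" a b ys] by (simp add: rep)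
  finally show ?thesis by (simp add: eq_neg_iff_add_eq_0)
qed

definition symmetric_form :: "('w::real_vector \<Rightarrow> 'w \<Rightarrow> real) \<Rightarrow> bool" where
  "symmetric_form G \<longleftrightarrow> (\<forall>a b c. G (a + b) c = G a c + G b c) \<and>
     (\<forall>r a b. G (r *\<^sub>R a) b = r * G a b) \<and> (\<forall>a b. G a b = G b a)"

definition sym2_functional :: "('w::real_vector \<Rightarrow> 'w \<Rightarrow> real) \<Rightarrow> 'w sym_square \<Rightarrow> real" where
  "sym2_functional G u = linear_extension (case_prod G) (rep_sym_square u)"

lemma sym2_functional_abs:
  assumes "symmetric_form G"
  shows "sym2_functional G (abs_sym_square f) = linear_extension (case_prod G) f"
proof -
  have "sym2_equiv (rep_sym_square (abs_sym_square f)) f"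
    by (rule Quotient_rep_abs[OF Quotient_sym_square])
      (simp add: sym2_equiv_def span_zero)
  then have "linear_extension (case_prod G) (rep_sym_square (abs_sym_square f) - f) = 0"
    unfolding sym2_equiv_def
  proof (rule linear_eq_0_on_span[OF linear_linear_extension, rotated])
    fix r assume "r \<in> (sym2_relations :: ('a \<times> 'a \<Rightarrow>\<^sub>0 real) set)"
    then show "linear_extension (case_prod G) r = 0"
      using assms unfolding sym2_relations_def symmetric_form_def
      by (auto simp: linear_extension_simps)
  qed
  then show ?thesis by (simp add: sym2_functional_def linear_extension_simps)
qed

lemma sym2_functional_linear:
  assumes "symmetric_form G"
  shows "linear (sym2_functional G)"
proof (rule linearI)
  fix v w :: "'a sym_square" and c
  show "sym2_functional G (v + w) = sym2_functional G v + sym2_functional G w"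
    by (induction v rule: sym_square.abs_induct; induction w rule: sym_square.abs_induct)
      (simp add: plus_sym_square.abs_eq sym2_functional_abs[OF assms] linear_add[OF linear_linear_extension])
  show "sym2_functional G (c *\<^sub>R v) = c *\<^sub>R sym2_functional G v"
    by (induction v rule: sym_square.abs_induct)
      (simp add: scaleR_sym_square.abs_eq sym2_functional_abs[OF assms] linear_extension_simps)
qed

lemma sym2_functional_vee: "symmetric_form G \<Longrightarrow> sym2_functional G (a \<or>\<^sub>s b) = G a b"
  by (simp add: vee.abs_eq sym2_functional_abs)

lemma sym2_relationsI:
  "\<langle>(a + b, c)\<rangle> - \<langle>(a, c)\<rangle> - \<langle>(b, c)\<rangle> \<in> sym2_relations"
  "\<langle>(r *\<^sub>R a, b)\<rangle> - r *\<^sub>R \<langle>(a, b)\<rangle> \<in> sym2_relations"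
  "\<langle>(a, b)\<rangle> - \<langle>(b, a)\<rangle> \<in> sym2_relations"
  unfolding sym2_relations_def by blast+

lemma vee_commute: "a \<or>\<^sub>s b = b \<or>\<^sub>s a"
  by transfer (unfold sym2_equiv_def, rule span_base, rule sym2_relationsI)

lemma vee_linear_left: "linear (\<lambda>a. a \<or>\<^sub>s b)"
proof (rule linearI)
  show "(a + c) \<or>\<^sub>s b = a \<or>\<^sub>s b + c \<or>\<^sub>s b" for a c
    by transfer (unfold sym2_equiv_def diff_diff_eq[symmetric], rule span_base, rule sym2_relationsI)
  show "(r *\<^sub>R a) \<or>\<^sub>s b = r *\<^sub>R (a \<or>\<^sub>s b)" for r a
    by transfer (unfold sym2_equiv_def, rule span_base, rule sym2_relationsI)
qed

lemma vee_linear_right: "linear (\<lambda>b. a \<or>\<^sub>s b)"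
  using vee_linear_left[of a] by (simp add: vee_commute[of a])

section \<open>Multi-indices and the basis of the exterior power\<close>

lemma multi_indices_set_inject:
  assumes "\<alpha> \<in> multi_indices n k" "\<beta> \<in> multi_indices n k" "set \<alpha> = set \<beta>"
  shows "\<alpha> = \<beta>"
  using assms by (auto simp: multi_indices_def intro: strict_sorted_equal)

lemma multi_indices_sorted_list:
  assumes "\<alpha> \<in> multi_indices n k"
  shows "sorted_list_of_set (set \<alpha>) = \<alpha>" "card (set \<alpha>) = k" "distinct \<alpha>" "length \<alpha> = k" "set \<alpha> \<subseteq> {1..n}"
  using assms by (auto simp: multi_indices_def strict_sorted_iff distinct_card sorted_list_of_set_sort_remdups
      distinct_remdups_id sorted_sort_id)

lemma finite_multi_indices: "finite (multi_indices n k)"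
  by (rule finite_subset[OF _ finite_lists_length_eq[of "{1..n}" k]]) (auto simp: multi_indices_def)

locale indexed_basis =
  fixes e :: "nat \<Rightarrow> 'v::real_vector" and n k :: nat
  assumes inj: "inj_on e {1..n}" and indep: "independent (e ` {1..n})" and spans: "span (e ` {1..n}) = UNIV"
begin

declare One_nat_def [simp del] (* keeps the simplifier from turning {1..n} into {Suc 0..n} *)

definition coord :: "'v \<Rightarrow> nat \<Rightarrow> real" where
  "coord x j = representation (e ` {1..n}) x (e j)"

lemma coord_add: "coord (x + y) = (\<lambda>j. coord x j + coord y j)"
  by (simp add: coord_def fun_eq_iff representation_add[OF indep] spans)

lemma coord_scaleR: "coord (c *\<^sub>R x) = (\<lambda>j. c * coord x j)"
  by (simp add: coord_def fun_eq_iff representation_scale[OF indep] spans)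

lemma coord_basis: "i \<in> {1..n} \<Longrightarrow> j \<in> {1..n} \<Longrightarrow> coord (e i) j = (if i = j then 1 else 0)"
  using inj by (auto simp: coord_def representation_basis[OF indep] inj_on_eq_iff)

lemma coord_sum:
  assumes "j \<in> {1..n}"
  shows "coord (\<Sum>i\<in>{1..n}. c i *\<^sub>R e i) j = c j"
proof -
  have lin: "linear (\<lambda>x. coord x j)" by (rule linearI) (simp_all add: coord_add coord_scaleR)
  have "coord (\<Sum>i\<in>{1..n}. c i *\<^sub>R e i) j = (\<Sum>i\<in>{1..n}. c i * coord (e i) j)"
    by (simp add: linear_sum[OF lin] linear_cmul[OF lin])
  also have "\<dots> = (\<Sum>i\<in>{1..n}. if i = j then c i else 0)"
    by (intro sum.cong refl) (use coord_basis[OF _ assms] in auto)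
  finally show ?thesis using assms by simp
qed

text \<open>The \<alpha>-th Pluecker coordinate of the tuple \<open>as\<close>; these forms induce
  the functionals dual to the wedge basis.\<close>

definition coord_minor :: "nat list \<Rightarrow> 'v list \<Rightarrow> real" where
  "coord_minor \<alpha> as = (if length as = k then minor k (\<lambda>i. coord (as ! i)) \<alpha> else 0)"

text \<open>Turns the varying entry of a tuple into an update of one row, the form of the row lemmas
  for minors; the 0 is a placeholder that the update overwrites.\<close>

lemma coord_minor_slot:
  assumes "Suc (length xs + length ys) = k"
  shows "coord_minor \<alpha> (xs @ x # ys) = minor k ((\<lambda>i. coord ((xs @ 0 # ys) ! i))(length xs := coord x)) \<alpha>"
  using assms unfolding coord_minor_def
  by (auto intro!: minor_cong simp: nth_append nth_Cons')

lemma alternating_coord_minor: "alternating_form (coord_minor \<alpha>)"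
  unfolding alternating_form_def
proof (intro conjI allI)
  fix xs ys zs and a b :: 'v and c
  show "coord_minor \<alpha> (xs @ (a + b) # ys) = coord_minor \<alpha> (xs @ a # ys) + coord_minor \<alpha> (xs @ b # ys)"
  proof (cases "Suc (length xs + length ys) = k")
    case True
    then show ?thesis
      unfolding coord_minor_slot[OF True] coord_add by (intro minor_row_add) simp
  qed (simp add: coord_minor_def)
  show "coord_minor \<alpha> (xs @ (c *\<^sub>R a) # ys) = c * coord_minor \<alpha> (xs @ a # ys)"
  proof (cases "Suc (length xs + length ys) = k")
    case True
    then show ?thesis
      unfolding coord_minor_slot[OF True] coord_scaleR by (intro minor_row_scale) simp
  qed (simp add: coord_minor_def)
  show "coord_minor \<alpha> (xs @ a # ys @ a # zs) = 0"
    unfolding coord_minor_def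
    using minor_identical_rows[of "length xs" k "Suc (length xs + length ys)"
        "\<lambda>i. coord ((xs @ a # ys @ a # zs) ! i)" \<alpha>]
    by (auto simp: nth_append)
qed

text \<open>For \<alpha> = \<beta> the matrix is the identity. Otherwise \<beta> has an entry
  outside \<alpha>, because both have k entries, and the row of that entry is 0.\<close>

lemma coord_minor_basis:
  assumes \<alpha>: "\<alpha> \<in> multi_indices n k" and \<beta>: "\<beta> \<in> multi_indices n k"
  shows "coord_minor \<alpha> (map e \<beta>) = (if \<alpha> = \<beta> then 1 else 0)"
proof -
  note \<alpha>' = multi_indices_sorted_list[OF \<alpha>] and \<beta>' = multi_indices_sorted_list[OF \<beta>]
  have nth: "\<alpha> ! i \<in> {1..n}" "\<beta> ! i \<in> {1..n}" if "i < k" for i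
    using \<alpha>'(4,5) \<beta>'(4,5) that by (metis nth_mem subsetD)+
  show ?thesis
  proof (cases "\<alpha> = \<beta>")
    case True
    have "Matrix.mat k k (\<lambda>(i, j). coord (map e \<beta> ! i) (\<alpha> ! j)) = 1\<^sub>m k"
      using \<alpha>' \<beta>' nth by (intro eq_matI) (auto simp: True coord_basis nth_eq_iff_index_eq)
    then show ?thesis using True \<beta>'(4) by (simp add: coord_minor_def minor_def)
  next
    case False
    have "\<not> set \<beta> \<subseteq> set \<alpha>"
      using False multi_indices_set_inject[OF \<alpha> \<beta>] card_subset_eq[of "set \<alpha>" "set \<beta>"] \<alpha>'(2) \<beta>'(2) by auto
    then obtain x where "x \<in> set \<beta>" "x \<notin> set \<alpha>" by blast
    then obtain i where i: "i < k" "\<beta> ! i \<notin> set \<alpha>" using \<beta>'(4) by (metis in_set_conv_nth)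
    have "coord_minor \<alpha> (map e \<beta>) = minor k ((\<lambda>i. coord (map e \<beta> ! i))(i := (\<lambda>j. 0 * 0))) \<alpha>"
      unfolding coord_minor_def using i \<beta>'(4) \<alpha>'(5) nth
      by (auto intro!: minor_cong simp: coord_basis)
    also have "\<dots> = 0" using minor_row_scale[OF i(1), of _ 0 "\<lambda>_. 0" \<alpha>] by simp
    finally show ?thesis using False by simp
  qed
qed

abbreviation wedge_basis :: "'v exterior set" where
  "wedge_basis \<equiv> basis_wedge e ` multi_indices n k"

text \<open>Linear on the whole exterior algebra and directly computable on wedges, whereas
  \<open>ext_coord\<close> goes through \<open>representation\<close>; by \<open>expansion\<close>
  the two agree on the span of the basis.\<close>

definition ecoord :: "nat list \<Rightarrow> 'v exterior \<Rightarrow> real" where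
  "ecoord \<alpha> = ext_functional (coord_minor \<alpha>)"

lemma ecoord_linear: "linear (ecoord \<alpha>)"
  unfolding ecoord_def by (rule ext_functional_linear[OF alternating_coord_minor])

lemma ecoord_wedge: "ecoord \<alpha> (wedge as) = coord_minor \<alpha> as"
  unfolding ecoord_def by (rule ext_functional_wedge[OF alternating_coord_minor])

lemma ecoord_basis_wedge:
  "\<alpha> \<in> multi_indices n k \<Longrightarrow> \<beta> \<in> multi_indices n k \<Longrightarrow> ecoord \<alpha> (basis_wedge e \<beta>) = (if \<alpha> = \<beta> then 1 else 0)"
  unfolding basis_wedge_def by (simp add: ecoord_wedge coord_minor_basis)

lemma inj_basis_wedge: "inj_on (basis_wedge e) (multi_indices n k)"
  by (rule inj_onI) (metis ecoord_basis_wedge zero_neq_one)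

lemma ecoord_sum:
  assumes "\<alpha> \<in> multi_indices n k"
  shows "ecoord \<alpha> (\<Sum>\<beta>\<in>multi_indices n k. c \<beta> *\<^sub>R basis_wedge e \<beta>) = c \<alpha>"
proof -
  have "ecoord \<alpha> (\<Sum>\<beta>\<in>multi_indices n k. c \<beta> *\<^sub>R basis_wedge e \<beta>)
      = (\<Sum>\<beta>\<in>multi_indices n k. c \<beta> * ecoord \<alpha> (basis_wedge e \<beta>))"
    by (simp add: linear_sum[OF ecoord_linear] linear_cmul[OF ecoord_linear])
  also have "\<dots> = (\<Sum>\<beta>\<in>multi_indices n k. if \<alpha> = \<beta> then c \<beta> else 0)"
    by (intro sum.cong refl) (simp add: ecoord_basis_wedge[OF assms])
  finally show ?thesis using assms finite_multi_indices by simp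
qed

lemma independent_wedge_basis: "independent wedge_basis"
proof
  assume "dependent wedge_basis"
  then obtain c b where b: "b \<in> wedge_basis" "c b \<noteq> 0" and sum: "(\<Sum>v\<in>wedge_basis. c v *\<^sub>R v) = 0"
    using dependent_finite[of wedge_basis] finite_multi_indices by auto
  obtain \<alpha> where \<alpha>: "\<alpha> \<in> multi_indices n k" "b = basis_wedge e \<alpha>" using b by auto
  have "(\<Sum>\<beta>\<in>multi_indices n k. c (basis_wedge e \<beta>) *\<^sub>R basis_wedge e \<beta>) = 0"
    using sum by (simp add: sum.reindex[OF inj_basis_wedge])
  then have "c (basis_wedge e \<alpha>) = ecoord \<alpha> 0"
    using ecoord_sum[OF \<alpha>(1), of "\<lambda>\<beta>. c (basis_wedge e \<beta>)"] by simp
  then show False using b \<alpha> linear_0[OF ecoord_linear] by simp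
qed

text \<open>Entries are expanded in the basis from left to right, the prefix \<open>is\<close>
  recording the basis vectors already chosen. A full tuple of basis vectors is sorted, or is 0 if it
  has a repetition.\<close>

lemma wedge_in_span:
  assumes "length as = k"
  shows "wedge as \<in> span wedge_basis"
proof -
  have "wedge (map e is @ ys) \<in> span wedge_basis"
    if "set is \<subseteq> {1..n}" "length is + length ys = k" for "is" ys
    using that
  proof (induction ys arbitrary: "is")
    case Nil
    have sort: "wedge (map e is) = tuple_sign is *\<^sub>R wedge (map e (sort is))"
      by (rule alternating_sort[of "\<lambda>is. wedge (map e is)"]) (unfold map_append list.map, rule wedge_swap)
    show ?case
    proof (cases "distinct is")
      case True
      then have "basis_wedge e (sort is) \<in> span wedge_basis"
        using Nil by (intro span_base imageI sort_in_multi_indices) auto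
      then show ?thesis
        unfolding append_Nil2 sort basis_wedge_def[of e "sort is", symmetric] by (rule span_scale)
    next
      case False
      then show ?thesis by (simp add: sort tuple_sign_not_distinct span_zero)
    qed
  next
    case (Cons y ys)
    have "y \<in> span (e ` {1..n})" by (simp add: spans)
    then show ?case
    proof (induction rule: span_induct_alt)
      case base
      have "wedge (map e is @ 0 # ys) = 0" using wedge_scaleR[of "map e is" 0 0 ys] by simp
      then show ?case by (simp add: span_zero)
    next
      case (step c x y)
      obtain i where i: "i \<in> {1..n}" "x = e i" using step by auto
      have "wedge (map e is @ x # ys) \<in> span wedge_basis"
        using Cons.IH[of "is @ [i]"] Cons.prems i by simp
      then show ?case using step by (simp add: wedge_add wedge_scaleR span_add span_scale)
    qed
  qed
  from this[of "[]" as] show ?thesis using assms by simp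
qed

lemma expansion:
  assumes "v \<in> span wedge_basis"
  shows "v = (\<Sum>\<alpha>\<in>multi_indices n k. ecoord \<alpha> v *\<^sub>R basis_wedge e \<alpha>)"
    and "\<alpha> \<in> multi_indices n k \<Longrightarrow> ext_coord n k e v \<alpha> = ecoord \<alpha> v"
proof -
  have "v = (\<Sum>b\<in>wedge_basis. representation wedge_basis v b *\<^sub>R b)"
    using sum_representation_eq[OF independent_wedge_basis assms, of wedge_basis] finite_multi_indices by simp
  also have "\<dots> = (\<Sum>\<alpha>\<in>multi_indices n k. ext_coord n k e v \<alpha> *\<^sub>R basis_wedge e \<alpha>)"
    by (simp add: sum.reindex[OF inj_basis_wedge] ext_coord_def)
  finally have v: "v = (\<Sum>\<alpha>\<in>multi_indices n k. ext_coord n k e v \<alpha> *\<^sub>R basis_wedge e \<alpha>)" .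
  show eq: "ext_coord n k e v \<alpha> = ecoord \<alpha> v" if "\<alpha> \<in> multi_indices n k" for \<alpha>
    using ecoord_sum[OF that, of "ext_coord n k e v"] v by simp
  then show "v = (\<Sum>\<alpha>\<in>multi_indices n k. ecoord \<alpha> v *\<^sub>R basis_wedge e \<alpha>)"
    using v by simp
qed

end

section \<open>The order on multi-indices, the sign of a vector, and the symmetric square\<close>

lemma mi_greater_irrefl: "\<not> \<alpha> \<succ> \<alpha>"
  by (auto simp: mi_greater_def lexord_irreflexive)

lemma mi_greater_trans: "\<alpha> \<succ> \<beta> \<Longrightarrow> \<beta> \<succ> \<gamma> \<Longrightarrow> \<alpha> \<succ> \<gamma>"
  unfolding mi_greater_def by (rule lexord_trans) auto

lemma mi_greater_linear: "\<alpha> \<succ> \<beta> \<or> \<alpha> = \<beta> \<or> \<beta> \<succ> \<alpha>"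
proof -
  have "\<forall>a b. (a, b) \<in> less_than \<or> a = b \<or> (b, a) \<in> less_than"
    by (simp add: less_linear)
  from lexord_linear[OF this, of \<alpha> \<beta>] show ?thesis unfolding mi_greater_def by blast
qed

lemma mi_greater_asym: "\<alpha> \<succ> \<beta> \<Longrightarrow> \<not> \<beta> \<succ> \<alpha>"
  using mi_greater_trans mi_greater_irrefl by blast

context indexed_basis
begin

lemma ext_sgn_uminus:
  assumes "v \<in> span wedge_basis"
  shows "ext_sgn n k e (- v) = - ext_sgn n k e v"
proof -
  have "ext_coord n k e (- v) = (\<lambda>\<alpha>. - ext_coord n k e v \<alpha>)"
    unfolding ext_coord_def representation_neg[OF independent_wedge_basis assms] ..
  then show ?thesis by (simp add: ext_sgn_def sgn_minus)
qed

text \<open>The support of a nonzero v is finite and nonempty, so it has a largest element for the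
  total order, and the description in \<open>ext_sgn\<close> denotes it.\<close>

lemma ext_sgn_cases:
  assumes v: "v \<in> span wedge_basis" "v \<noteq> 0"
  shows "ext_sgn n k e v \<in> {1, -1}"
proof -
  define S where "S = {\<alpha> \<in> multi_indices n k. ext_coord n k e v \<alpha> \<noteq> 0}"
  have "S \<noteq> {}"
  proof
    assume "S = {}"
    then have "ecoord \<alpha> v = 0" if "\<alpha> \<in> multi_indices n k" for \<alpha>
      using expansion(2)[OF v(1) that] that by (auto simp: S_def)
    then have "(\<Sum>\<alpha>\<in>multi_indices n k. ecoord \<alpha> v *\<^sub>R basis_wedge e \<alpha>) = 0" by simp
    then show False using expansion(1)[OF v(1)] v(2) by simp
  qed
  moreover have "finite S" using finite_multi_indices by (simp add: S_def)
  moreover have "transp_on S (\<succ>)" by (rule transp_onI) (rule mi_greater_trans)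
  moreover have "totalp_on S (\<succ>)" by (rule totalp_onI) (use mi_greater_linear in blast)
  ultimately obtain \<alpha> where \<alpha>: "\<alpha> \<in> S" "\<forall>\<beta>\<in>S. \<beta> \<noteq> \<alpha> \<longrightarrow> \<alpha> \<succ> \<beta>"
    using Finite_Set.bex_least_element[of S "(\<succ>)"] by blast
  have "(THE \<alpha>. \<alpha> \<in> multi_indices n k \<and> ext_coord n k e v \<alpha> \<noteq> 0 \<and>
        (\<forall>\<beta>\<in>multi_indices n k. ext_coord n k e v \<beta> \<noteq> 0 \<longrightarrow> \<beta> = \<alpha> \<or> \<alpha> \<succ> \<beta>)) = \<alpha>"
    using \<alpha> mi_greater_asym by (intro the_equality) (auto simp: S_def)
  then show ?thesis using \<alpha>(1) by (auto simp: ext_sgn_def S_def sgn_if)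
qed

text \<open>Symmetrising makes the form well defined on the symmetric square; at \<alpha> = \<beta>
  it is twice the product, the source of the factor 2 in
  \<open>sym_coord_combination\<close>.\<close>

definition sym_coord :: "nat list \<Rightarrow> nat list \<Rightarrow> 'v exterior sym_square \<Rightarrow> real" where
  "sym_coord \<alpha> \<beta> = sym2_functional (\<lambda>v w. ecoord \<alpha> v * ecoord \<beta> w + ecoord \<beta> v * ecoord \<alpha> w)"

lemma symmetric_form_ecoord:
  "symmetric_form (\<lambda>v w. ecoord \<alpha> v * ecoord \<beta> w + ecoord \<beta> v * ecoord \<alpha> w)"
  by (simp add: symmetric_form_def linear_add[OF ecoord_linear] linear_cmul[OF ecoord_linear] algebra_simps)

lemmas sym_coord_linear = sym2_functional_linear[OF symmetric_form_ecoord, folded sym_coord_def]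
lemmas sym_coord_vee = sym2_functional_vee[OF symmetric_form_ecoord, folded sym_coord_def]

lemma sym_coord_commute: "sym_coord \<alpha> \<beta> = sym_coord \<beta> \<alpha>"
  unfolding sym_coord_def by (simp add: add.commute)

definition index_pairs :: "(nat list \<times> nat list) set" where
  "index_pairs = {(\<alpha>, \<beta>). \<alpha> \<in> multi_indices n k \<and> \<beta> \<in> multi_indices n k \<and> (\<alpha> = \<beta> \<or> \<alpha> \<succ> \<beta>)}"

lemma finite_index_pairs: "finite index_pairs"
  by (rule finite_subset[of _ "multi_indices n k \<times> multi_indices n k"])
    (auto simp: index_pairs_def finite_multi_indices)

definition sym_combination :: "(nat list \<Rightarrow> nat list \<Rightarrow> real) \<Rightarrow> 'v exterior sym_square" where
  "sym_combination q = (\<Sum>(\<alpha>, \<beta>)\<in>index_pairs. q \<alpha> \<beta> *\<^sub>R (basis_wedge e \<alpha> \<or>\<^sub>s basis_wedge e \<beta>))"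

text \<open>Recovers the coefficients from the element, and so stands in for the linear independence
  of the products of basis vectors.\<close>

lemma sym_coord_combination:
  assumes \<alpha>: "\<alpha> \<in> multi_indices n k" and \<beta>: "\<beta> \<in> multi_indices n k"
  shows "sym_coord \<alpha> \<beta> (sym_combination q) = (if \<alpha> = \<beta> then 2 else 1) * extend_coeff q \<alpha> \<beta>"
proof -
  have main: "sym_coord \<alpha> \<beta> (sym_combination q) = (if \<alpha> = \<beta> then 2 else 1) * q \<alpha> \<beta>"
    if p: "(\<alpha>, \<beta>) \<in> index_pairs" for \<alpha> \<beta>
  proof -
    have mem: "\<alpha> \<in> multi_indices n k" "\<beta> \<in> multi_indices n k" using p by (auto simp: index_pairs_def)
    have "sym_coord \<alpha> \<beta> (sym_combination q)
        = (\<Sum>(\<gamma>, \<delta>)\<in>index_pairs. q \<gamma> \<delta> * sym_coord \<alpha> \<beta> (basis_wedge e \<gamma> \<or>\<^sub>s basis_wedge e \<delta>))"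
      unfolding sym_combination_def linear_sum[OF sym_coord_linear]
      by (simp add: case_prod_beta linear_cmul[OF sym_coord_linear])
    also have "\<dots> = (\<Sum>p\<in>index_pairs. if p = (\<alpha>, \<beta>) then (if \<alpha> = \<beta> then 2 else 1) * q \<alpha> \<beta> else 0)"
    proof (rule sum.cong[OF refl], clarify)
      fix \<gamma> \<delta> assume pd: "(\<gamma>, \<delta>) \<in> index_pairs"
      then have mem': "\<gamma> \<in> multi_indices n k" "\<delta> \<in> multi_indices n k" by (auto simp: index_pairs_def)
      \<comment> \<open>The form also responds to the reversed pair, but a pair and its reverse are
        both in \<open>index_pairs\<close> only on the diagonal.\<close>
      have "\<gamma> = \<beta> \<and> \<delta> = \<alpha> \<Longrightarrow> \<alpha> = \<beta>"
        using p pd mi_greater_asym by (auto simp: index_pairs_def)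
      then show "q \<gamma> \<delta> * sym_coord \<alpha> \<beta> (basis_wedge e \<gamma> \<or>\<^sub>s basis_wedge e \<delta>)
          = (if (\<gamma>, \<delta>) = (\<alpha>, \<beta>) then (if \<alpha> = \<beta> then 2 else 1) * q \<alpha> \<beta> else 0)"
        by (auto simp: sym_coord_vee ecoord_basis_wedge mem mem')
    qed
    also have "\<dots> = (if \<alpha> = \<beta> then 2 else 1) * q \<alpha> \<beta>" using p finite_index_pairs by simp
    finally show ?thesis .
  qed
  show ?thesis
  proof (cases "\<beta> \<succ> \<alpha>")
    case True
    then show ?thesis
      using main[of \<beta> \<alpha>] \<alpha> \<beta> mi_greater_irrefl
      by (auto simp: extend_coeff_multi_indices[OF \<alpha> \<beta>] sym_coord_commute[of \<alpha>] index_pairs_def)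
  next
    case False
    then show ?thesis
      using main[of \<alpha> \<beta>] \<alpha> \<beta> mi_greater_linear[of \<alpha> \<beta>]
      by (auto simp: extend_coeff_multi_indices[OF \<alpha> \<beta>] index_pairs_def)
  qed
qed

text \<open>All pairs split into those with \<alpha> \<ge> \<beta> and the reversed strict ones;
  commutativity folds the latter onto the former and doubles the off-diagonal terms.\<close>

lemma scaled_square_expansion:
  assumes v: "v = (\<Sum>\<alpha>\<in>multi_indices n k. w \<alpha> *\<^sub>R basis_wedge e \<alpha>)"
  shows "c *\<^sub>R (v \<or>\<^sub>s v) = sym_combination (\<lambda>\<alpha> \<beta>. c * ((if \<alpha> = \<beta> then 1 else 2) * (w \<alpha> * w \<beta>)))"
proof -
  let ?M = "multi_indices n k"
  define f where "f = (\<lambda>(\<alpha>, \<beta>). (w \<alpha> * w \<beta>) *\<^sub>R (basis_wedge e \<alpha> \<or>\<^sub>s basis_wedge e \<beta>))"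
  define D where "D = {(\<alpha>, \<beta>). \<alpha> \<in> ?M \<and> \<beta> \<in> ?M \<and> \<alpha> \<succ> \<beta>}"
  have finD: "finite D"
    by (rule finite_subset[OF _ finite_index_pairs]) (auto simp: D_def index_pairs_def)
  have "v \<or>\<^sub>s v = (\<Sum>\<alpha>\<in>?M. \<Sum>\<beta>\<in>?M. f (\<alpha>, \<beta>))"
  proof -
    have "v \<or>\<^sub>s v = (\<Sum>\<alpha>\<in>?M. w \<alpha> *\<^sub>R (basis_wedge e \<alpha> \<or>\<^sub>s v))"
      by (subst v) (simp add: linear_sum[OF vee_linear_left] linear_cmul[OF vee_linear_left])
    also have "\<dots> = (\<Sum>\<alpha>\<in>?M. w \<alpha> *\<^sub>R (\<Sum>\<beta>\<in>?M. w \<beta> *\<^sub>R (basis_wedge e \<alpha> \<or>\<^sub>s basis_wedge e \<beta>)))"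
      by (subst v) (simp add: linear_sum[OF vee_linear_right] linear_cmul[OF vee_linear_right])
    finally show ?thesis by (simp add: f_def scaleR_sum_right)
  qed
  also have "\<dots> = (\<Sum>p\<in>?M \<times> ?M. f p)" by (simp add: sum.cartesian_product)
  also have "?M \<times> ?M = index_pairs \<union> prod.swap ` D"
  proof -
    have "\<not> \<alpha> \<succ> \<beta> \<Longrightarrow> \<not> \<beta> \<succ> \<alpha> \<Longrightarrow> \<alpha> = \<beta>" for \<alpha> \<beta> using mi_greater_linear by blast
    then show ?thesis by (auto simp: index_pairs_def D_def image_iff)
  qed
  also have "(\<Sum>p\<in>index_pairs \<union> prod.swap ` D. f p) = (\<Sum>p\<in>index_pairs. f p) + (\<Sum>p\<in>prod.swap ` D. f p)"
    by (rule sum.union_disjoint)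
      (use finD finite_index_pairs mi_greater_asym mi_greater_irrefl in \<open>auto simp: index_pairs_def D_def\<close>)
  also have "(\<Sum>p\<in>prod.swap ` D. f p) = (\<Sum>p\<in>D. f p)"
    by (rule sum.reindex_cong[of prod.swap]) (auto simp: f_def mult.commute vee_commute)
  also have "(\<Sum>p\<in>D. f p) = (\<Sum>p\<in>index_pairs. if fst p = snd p then 0 else f p)"
    by (rule sum.mono_neutral_cong_left)
      (use finite_index_pairs mi_greater_irrefl in \<open>auto simp: index_pairs_def D_def\<close>)
  also have "(\<Sum>p\<in>index_pairs. f p) + \<dots> = (\<Sum>(\<alpha>, \<beta>)\<in>index_pairs.
      ((if \<alpha> = \<beta> then 1 else 2) * (w \<alpha> * w \<beta>)) *\<^sub>R (basis_wedge e \<alpha> \<or>\<^sub>s basis_wedge e \<beta>))"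
    unfolding sum.distrib[symmetric]
    by (intro sum.cong refl) (auto simp: f_def scaleR_2 simp flip: scaleR_scaleR)
  finally show ?thesis
    by (simp add: sym_combination_def scaleR_sum_right case_prod_beta)
qed

text \<open>Row \<open>l\<close> of the matrix holds the coordinates \<open>w\<close> of the tuples obtained from \<open>\<alpha>\<^sub>0\<close> by
  replacing its \<open>l\<close>-th entry, divided by \<open>w \<alpha>\<^sub>0\<close>, so that its minor at \<open>\<alpha>\<^sub>0\<close> is that of the identity.\<close>

lemma plucker_imp_decomposable:
  assumes k: "1 \<le> k" and w: "plucker_relations n k w"
    and \<alpha>\<^sub>0: "\<alpha>\<^sub>0 \<in> multi_indices n k" "w (set \<alpha>\<^sub>0) \<noteq> 0"
  obtains v where "v \<in> decomposable k" "v \<in> span wedge_basis"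
    "\<And>\<alpha>. \<alpha> \<in> multi_indices n k \<Longrightarrow> ecoord \<alpha> v = w (set \<alpha>)"
proof -
  note \<alpha>' = multi_indices_sorted_list[OF \<alpha>\<^sub>0(1)]
  \<comment> \<open>\<open>tuple_sign\<close> is 0 when j already occurs at another position of
    \<open>\<alpha>\<^sub>0\<close>, which yields the identity on the columns of
    \<open>\<alpha>\<^sub>0\<close>.\<close>
  define a where "a = (\<lambda>l j. tuple_sign (\<alpha>\<^sub>0[l := j]) * w (set (\<alpha>\<^sub>0[l := j])) / w (set \<alpha>\<^sub>0))"
  \<comment> \<open>Scaling one row by \<open>w (set \<alpha>\<^sub>0)\<close> scales every minor by
    it and so undoes the normalisation; k \<ge> 1 provides the row.\<close>
  define b where "b = a(0 := (\<lambda>j. w (set \<alpha>\<^sub>0) * a 0 j))"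
  have k0: "0 < k" using k by simp
  have b: "minor k b ts = w (set \<alpha>\<^sub>0) * minor k a ts" for ts
    unfolding b_def using minor_row_scale[OF k0, of a "w (set \<alpha>\<^sub>0)" "a 0" ts] by simp
  have a_\<alpha>\<^sub>0: "a i (\<alpha>\<^sub>0 ! m) = (if i = m then 1 else 0)" if "i < k" "m < k" for i m
  proof (cases "i = m")
    case True
    have "tuple_sign \<alpha>\<^sub>0 = 1" using \<alpha>\<^sub>0(1) by (intro tuple_sign_sorted) (simp add: multi_indices_def)
    then show ?thesis using True \<alpha>\<^sub>0(2) by (simp add: a_def)
  next
    case False
    have "\<alpha>\<^sub>0[i := \<alpha>\<^sub>0 ! m] ! i = \<alpha>\<^sub>0[i := \<alpha>\<^sub>0 ! m] ! m" using False that \<alpha>'(4) by simp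
    then have "\<not> distinct (\<alpha>\<^sub>0[i := \<alpha>\<^sub>0 ! m])"
      using False that \<alpha>'(4) by (metis length_list_update nth_eq_iff_index_eq)
    then show ?thesis using False by (simp add: a_def tuple_sign_not_distinct)
  qed
  \<comment> \<open>The submatrix is the identity with column l replaced, so Cramer's rule gives its
    determinant as the l-th entry of that column.\<close>
  have minor_upd: "minor k a (\<alpha>\<^sub>0[l := j]) = a l j" if l: "l < k" for l j
  proof -
    define x where "x = Matrix.vec k (\<lambda>i. a i j)"
    have "Matrix.mat k k (\<lambda>(i, m). a i (\<alpha>\<^sub>0[l := j] ! m)) = replace_col (1\<^sub>m k) (1\<^sub>m k *\<^sub>v x) l"
      using \<alpha>'(4) a_\<alpha>\<^sub>0 by (intro eq_matI) (auto simp: replace_col_def nth_list_update x_def)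
    then have "minor k a (\<alpha>\<^sub>0[l := j]) = Determinant.det (replace_col (1\<^sub>m k) (1\<^sub>m k *\<^sub>v x) l)"
      using \<alpha>'(4) by (simp add: minor_def)
    also have "\<dots> = Matrix.vec_index x l * Determinant.det (1\<^sub>m k :: real Matrix.mat)"
      by (rule cramer_lemma_mat) (use l in \<open>auto simp: x_def\<close>)
    finally show ?thesis using l by (simp add: x_def)
  qed
  define as where "as = map (\<lambda>l. \<Sum>j\<in>{1..n}. b l j *\<^sub>R e j) [0..<k]"
  define v where "v = wedge as"
  define w' where "w' = (\<lambda>S. minor k b (sorted_list_of_set S))"
  have w'_eq: "w' S = w S" if S: "S \<subseteq> {1..n}" "card S = k" for S
  proof (rule plucker_determined[OF w _ \<alpha>'(5,2) \<alpha>\<^sub>0(2) _ _ S])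
    show "plucker_relations n k w'" unfolding w'_def by (rule plucker_relations_minor)
    have "minor k a \<alpha>\<^sub>0 = 1"
      using minor_upd[OF k0, of "\<alpha>\<^sub>0 ! 0"] a_\<alpha>\<^sub>0[OF k0 k0] by simp
    then show "w' (set \<alpha>\<^sub>0) = w (set \<alpha>\<^sub>0)" by (simp add: w'_def \<alpha>' b)
  next
    fix i j assume i: "i \<in> set \<alpha>\<^sub>0" and j: "j \<in> {1..n} - set \<alpha>\<^sub>0"
    obtain l where l: "l < k" "i = \<alpha>\<^sub>0 ! l" using i \<alpha>'(4) by (metis in_set_conv_nth)
    define ts where "ts = \<alpha>\<^sub>0[l := j]"
    have set_ts: "set ts = insert j (set \<alpha>\<^sub>0 - {i})"
      unfolding ts_def l(2) by (rule set_update_distinct) (use \<alpha>' l in auto)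
    have dist: "distinct ts" unfolding ts_def using \<alpha>'(3) j by (simp add: distinct_list_update)
    have "tuple_sign ts * minor k b (sort ts) = minor k b ts" by (rule minor_sort[symmetric])
    also have "\<dots> = tuple_sign ts * w (set ts)"
      using minor_upd[OF l(1), of j] \<alpha>\<^sub>0(2) by (simp add: b ts_def[symmetric] a_def)
    finally have "minor k b (sort ts) = w (set ts)"
      using tuple_sign_mult_self[OF dist] by auto
    then have "w' (set ts) = w (set ts)"
      using dist by (simp add: w'_def sorted_list_of_set_sort_remdups distinct_remdups_id)
    then show "w' (insert j (set \<alpha>\<^sub>0 - {i})) = w (insert j (set \<alpha>\<^sub>0 - {i}))" by (simp only: set_ts)
  qed
  have coord: "ecoord \<alpha> v = w (set \<alpha>)" if \<alpha>: "\<alpha> \<in> multi_indices n k" for \<alpha>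
  proof -
    note \<alpha>'' = multi_indices_sorted_list[OF \<alpha>]
    have "ecoord \<alpha> v = minor k (\<lambda>i. coord (as ! i)) \<alpha>"
      by (simp add: v_def ecoord_wedge coord_minor_def as_def)
    also have "\<dots> = minor k b \<alpha>"
      using \<alpha>''(5) by (intro minor_cong) (auto simp: as_def coord_sum)
    also have "\<dots> = w' (set \<alpha>)" by (simp add: w'_def \<alpha>'')
    finally show ?thesis using w'_eq \<alpha>'' by simp
  qed
  have "v \<noteq> 0" using coord[OF \<alpha>\<^sub>0(1)] \<alpha>\<^sub>0(2) linear_0[OF ecoord_linear] by auto
  moreover have "length as = k" by (simp add: as_def)
  ultimately have "v \<in> decomposable k" by (auto simp: decomposable_def v_def)
  moreover have "v \<in> span wedge_basis" unfolding v_def by (rule wedge_in_span) (simp add: as_def)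
  ultimately show ?thesis using that coord by blast
qed

lemma decomposable_imp_plucker:
  assumes "v \<in> decomposable k"
  obtains w where "plucker_relations n k w" "\<And>\<alpha>. \<alpha> \<in> multi_indices n k \<Longrightarrow> ecoord \<alpha> v = w (set \<alpha>)"
proof -
  obtain as where as: "length as = k" "v = wedge as" using assms by (auto simp: decomposable_def)
  have "ecoord \<alpha> v = minor k (\<lambda>i. coord (as ! i)) (sorted_list_of_set (set \<alpha>))"
    if "\<alpha> \<in> multi_indices n k" for \<alpha>
    using as by (simp add: ecoord_wedge coord_minor_def multi_indices_sorted_list[OF that])
  then show ?thesis using that plucker_relations_minor by blast
qed

section \<open>The two implications of the theorem\<close>

lemma signed_square_imp_relations:
  assumes "v \<in> decomposable k" and u: "sym_combination q = signed_square n k e v"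
  defines "Q \<equiv> extend_coeff q"
  shows "linear_relations n k q" (is ?linear)
    and "\<forall>\<alpha>\<in>multi_indices n k. \<forall>\<beta>\<in>multi_indices n k. \<alpha> \<noteq> \<beta> \<longrightarrow>
      (Q \<alpha> \<beta>)\<^sup>2 - 4 * Q \<alpha> \<alpha> * Q \<beta> \<beta> = 0" (is ?square)
    and "\<forall>\<alpha>\<in>multi_indices n k. \<forall>\<beta>\<in>multi_indices n k. \<forall>\<gamma>\<in>multi_indices n k.
      \<alpha> \<noteq> \<beta> \<and> \<alpha> \<noteq> \<gamma> \<and> \<beta> \<noteq> \<gamma> \<longrightarrow> Q \<alpha> \<beta> * Q \<alpha> \<gamma> - 2 * Q \<alpha> \<alpha> * Q \<beta> \<gamma> = 0" (is ?triple)
proof -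
  obtain w where w: "plucker_relations n k w"
    and coord: "\<And>\<alpha>. \<alpha> \<in> multi_indices n k \<Longrightarrow> ecoord \<alpha> v = w (set \<alpha>)"
    using decomposable_imp_plucker[OF assms(1)] by blast
  define \<epsilon> where "\<epsilon> = ext_sgn n k e v"
  \<comment> \<open>Both sides are the value of \<open>sym_coord \<alpha> \<beta>\<close> on the
    same element, computed from its coefficients and from its form as a scaled square.\<close>
  have key: "(if \<alpha> = \<beta> then 2 else 1) * Q \<alpha> \<beta> = 2 * \<epsilon> * (w (set \<alpha>) * w (set \<beta>))"
    if "\<alpha> \<in> multi_indices n k" "\<beta> \<in> multi_indices n k" for \<alpha> \<beta>
  proof -
    have "(if \<alpha> = \<beta> then 2 else 1) * Q \<alpha> \<beta> = sym_coord \<alpha> \<beta> (\<epsilon> *\<^sub>R (v \<or>\<^sub>s v))"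
      unfolding Q_def sym_coord_combination[OF that, symmetric] u
      by (simp add: signed_square_def \<epsilon>_def)
    then show ?thesis
      by (simp add: linear_cmul[OF sym_coord_linear] sym_coord_vee coord[OF that(1)] coord[OF that(2)])
  qed
  have Q: "Q \<alpha> \<beta> = 2 * \<epsilon> * (w (set \<alpha>) * w (set \<beta>))" if "\<alpha> \<noteq> \<beta>" "\<alpha> \<in> multi_indices n k" "\<beta> \<in> multi_indices n k" for \<alpha> \<beta>
    using key[OF that(2,3)] that(1) by simp
  have Q': "Q \<alpha> \<alpha> = \<epsilon> * (w (set \<alpha>) * w (set \<alpha>))" if "\<alpha> \<in> multi_indices n k" for \<alpha>
    using key[OF that that] by simp
  show ?linear
    by (rule plucker_imp_linear_relations[where \<epsilon> = \<epsilon>, OF _ w]) (use Q in \<open>simp add: Q_def\<close>)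
  show ?square by (auto simp: Q Q' power2_eq_square)
  show ?triple by (auto simp: Q Q')
qed

text \<open>(ii) and (iii) are vanishing 2 by 2 minors of the symmetric matrix with entries Q
  \<alpha> \<alpha> on the diagonal and Q \<alpha> \<beta> / 2 off it. They force it to be a sign
  times c \<alpha> * c \<beta>, with c read off the row of a nonzero diagonal entry.\<close>

lemma relations_imp_signed_square:
  assumes k: "1 \<le> k" and nonzero: "sym_combination q \<noteq> 0"
  defines "Q \<equiv> extend_coeff q"
  assumes lin: "linear_relations n k q"
    and sq: "\<forall>\<alpha>\<in>multi_indices n k. \<forall>\<beta>\<in>multi_indices n k. \<alpha> \<noteq> \<beta> \<longrightarrow>
      (Q \<alpha> \<beta>)\<^sup>2 - 4 * Q \<alpha> \<alpha> * Q \<beta> \<beta> = 0"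
    and triple: "\<forall>\<alpha>\<in>multi_indices n k. \<forall>\<beta>\<in>multi_indices n k. \<forall>\<gamma>\<in>multi_indices n k.
      \<alpha> \<noteq> \<beta> \<and> \<alpha> \<noteq> \<gamma> \<and> \<beta> \<noteq> \<gamma> \<longrightarrow> Q \<alpha> \<beta> * Q \<alpha> \<gamma> - 2 * Q \<alpha> \<alpha> * Q \<beta> \<gamma> = 0"
  shows "sym_combination q \<in> signed_square n k e ` decomposable k"
proof -
  let ?M = "multi_indices n k"
  have Q_sym: "Q \<alpha> \<beta> = Q \<beta> \<alpha>" for \<alpha> \<beta> unfolding Q_def by (rule extend_coeff_sym)
  have q_Q: "q \<alpha> \<beta> = Q \<alpha> \<beta>" if "(\<alpha>, \<beta>) \<in> index_pairs" for \<alpha> \<beta>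
    using that mi_greater_asym mi_greater_irrefl unfolding Q_def index_pairs_def
    by (auto simp: extend_coeff_multi_indices)
  have "\<exists>(\<alpha>, \<beta>)\<in>index_pairs. q \<alpha> \<beta> \<noteq> 0"
    using nonzero unfolding sym_combination_def by (force intro: sum.neutral)
  then obtain \<alpha>\<^sub>1 \<beta>\<^sub>1 where "\<alpha>\<^sub>1 \<in> ?M" "\<beta>\<^sub>1 \<in> ?M" "Q \<alpha>\<^sub>1 \<beta>\<^sub>1 \<noteq> 0"
    using q_Q by (auto simp: index_pairs_def)
  \<comment> \<open>By (ii) a nonzero off-diagonal coefficient forces nonzero diagonal ones.\<close>
  then obtain \<alpha>\<^sub>0 where \<alpha>\<^sub>0: "\<alpha>\<^sub>0 \<in> ?M" "Q \<alpha>\<^sub>0 \<alpha>\<^sub>0 \<noteq> 0"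
    using sq by (cases "\<alpha>\<^sub>1 = \<beta>\<^sub>1") force+
  define \<epsilon> where "\<epsilon> = sgn (Q \<alpha>\<^sub>0 \<alpha>\<^sub>0)"
  define m where "m = sqrt \<bar>Q \<alpha>\<^sub>0 \<alpha>\<^sub>0\<bar>"
  have \<epsilon>: "\<epsilon> * \<epsilon> = 1" "\<epsilon> \<noteq> 0" "\<epsilon> \<in> {1, -1}" using \<alpha>\<^sub>0(2) by (auto simp: \<epsilon>_def sgn_if)
  have m: "m \<noteq> 0" "Q \<alpha>\<^sub>0 \<alpha>\<^sub>0 = \<epsilon> * m\<^sup>2"
    using \<alpha>\<^sub>0(2) by (auto simp: m_def \<epsilon>_def sgn_mult_abs)
  \<comment> \<open>The value at \<open>\<alpha>\<^sub>0\<close> is forced up to sign by the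
    diagonal entry; the other values solve the equations of its row.\<close>
  define c where "c = (\<lambda>\<beta>. if \<beta> = \<alpha>\<^sub>0 then m else Q \<alpha>\<^sub>0 \<beta> / (2 * \<epsilon> * m))"
  have row: "Q \<alpha>\<^sub>0 \<beta> = 2 * \<epsilon> * (m * c \<beta>)" if "\<beta> \<noteq> \<alpha>\<^sub>0" for \<beta>
    using that \<epsilon>(2) m(1) by (simp add: c_def)
  have diag: "Q \<beta> \<beta> = \<epsilon> * (c \<beta> * c \<beta>)" if \<beta>: "\<beta> \<in> ?M" for \<beta>
  proof (cases "\<beta> = \<alpha>\<^sub>0")
    case True
    then show ?thesis using m by (simp add: c_def power2_eq_square)
  next
    case False
    then have "(2 * \<epsilon> * (m * c \<beta>))\<^sup>2 = 4 * (\<epsilon> * m\<^sup>2) * Q \<beta> \<beta>"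
      using sq \<alpha>\<^sub>0(1) \<beta> row[OF False] m(2) by force
    then have "(4 * \<epsilon> * m\<^sup>2) * (\<epsilon> * (c \<beta> * c \<beta>)) = (4 * \<epsilon> * m\<^sup>2) * Q \<beta> \<beta>"
      by (simp add: power2_eq_square algebra_simps)
    then show ?thesis using \<epsilon>(2) m(1) by simp
  qed
  have off: "Q \<beta> \<gamma> = 2 * \<epsilon> * (c \<beta> * c \<gamma>)" if \<beta>\<gamma>: "\<beta> \<in> ?M" "\<gamma> \<in> ?M" "\<beta> \<noteq> \<gamma>" for \<beta> \<gamma>
  proof -
    consider "\<beta> = \<alpha>\<^sub>0" | "\<gamma> = \<alpha>\<^sub>0" | "\<beta> \<noteq> \<alpha>\<^sub>0" "\<gamma> \<noteq> \<alpha>\<^sub>0" by blast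
    then show ?thesis
    proof cases
      case 1
      then show ?thesis using row[of \<gamma>] \<beta>\<gamma> by (simp add: c_def)
    next
      case 2
      then show ?thesis using row[of \<beta>] \<beta>\<gamma> by (simp add: c_def Q_sym[of \<beta>])
    next
      case 3
      \<comment> \<open>This is (iii) with \<open>\<alpha>\<^sub>0\<close> as its first
        index.\<close>
      then have "(2 * \<epsilon> * (m * c \<beta>)) * (2 * \<epsilon> * (m * c \<gamma>)) = 2 * (\<epsilon> * m\<^sup>2) * Q \<beta> \<gamma>"
        using triple \<alpha>\<^sub>0(1) \<beta>\<gamma> row m(2) by force
      then have "(2 * \<epsilon> * m\<^sup>2) * (2 * \<epsilon> * (c \<beta> * c \<gamma>)) = (2 * \<epsilon> * m\<^sup>2) * Q \<beta> \<gamma>"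
        by (simp add: power2_eq_square algebra_simps)
      then show ?thesis using \<epsilon>(2) m(1) by simp
    qed
  qed
  define w where "w = (\<lambda>S. c (sorted_list_of_set S))"
  have w_set: "w (set \<alpha>) = c \<alpha>" if "\<alpha> \<in> ?M" for \<alpha>
    by (simp add: w_def multi_indices_sorted_list[OF that])
  have "plucker_relations n k w"
    by (rule linear_relations_imp_plucker[OF _ \<epsilon>(2) lin]) (use off in \<open>simp add: Q_def w_set\<close>)
  moreover have "w (set \<alpha>\<^sub>0) \<noteq> 0" using m(1) by (simp add: w_set[OF \<alpha>\<^sub>0(1)] c_def)
  ultimately obtain v where v: "v \<in> decomposable k" "v \<in> span wedge_basis"
    and coord: "\<And>\<alpha>. \<alpha> \<in> ?M \<Longrightarrow> ecoord \<alpha> v = c \<alpha>"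
    using plucker_imp_decomposable[OF k _ \<alpha>\<^sub>0(1), of w] w_set by metis
  have v0: "v \<noteq> 0" using v(1) by (simp add: decomposable_def)
  have "v = (\<Sum>\<alpha>\<in>?M. c \<alpha> *\<^sub>R basis_wedge e \<alpha>)"
    using expansion(1)[OF v(2)] coord by simp
  then have "\<epsilon> *\<^sub>R (v \<or>\<^sub>s v) = sym_combination (\<lambda>\<alpha> \<beta>. \<epsilon> * ((if \<alpha> = \<beta> then 1 else 2) * (c \<alpha> * c \<beta>)))"
    by (rule scaled_square_expansion)
  also have "\<dots> = sym_combination q"
    unfolding sym_combination_def
  proof (intro sum.cong refl, clarify)
    fix \<alpha> \<beta> assume p: "(\<alpha>, \<beta>) \<in> index_pairs"
    then have "\<alpha> \<in> ?M" "\<beta> \<in> ?M" by (auto simp: index_pairs_def)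
    then have "\<epsilon> * ((if \<alpha> = \<beta> then 1 else 2) * (c \<alpha> * c \<beta>)) = q \<alpha> \<beta>"
      using diag off q_Q[OF p] by auto
    then show "(\<epsilon> * ((if \<alpha> = \<beta> then 1 else 2) * (c \<alpha> * c \<beta>))) *\<^sub>R (basis_wedge e \<alpha> \<or>\<^sub>s basis_wedge e \<beta>)
        = q \<alpha> \<beta> *\<^sub>R (basis_wedge e \<alpha> \<or>\<^sub>s basis_wedge e \<beta>)" by simp
  qed
  finally have u: "sym_combination q = \<epsilon> *\<^sub>R (v \<or>\<^sub>s v)" ..
  show ?thesis
  proof (cases "ext_sgn n k e v = \<epsilon>")
    case True
    then show ?thesis using u v(1) by (auto simp: signed_square_def)
  next
    \<comment> \<open>v and -v have the same square but opposite \<open>ext_sgn\<close>, so one of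
      the two has sign \<epsilon>.\<close>
    case False
    then have sgn: "ext_sgn n k e (- v) = \<epsilon>"
      using ext_sgn_uminus[OF v(2)] ext_sgn_cases[OF v(2) v0] \<epsilon>(3) by auto
    have "(- v) \<or>\<^sub>s (- v) = v \<or>\<^sub>s v"
      by (simp add: linear_neg[OF vee_linear_left] linear_neg[OF vee_linear_right])
    then have "sym_combination q = signed_square n k e (- v)" using u sgn by (simp add: signed_square_def)
    \<comment> \<open>Negation is absorbed into the first factor, which exists since k \<ge>
      1.\<close>
    moreover have "- v \<in> decomposable k"
    proof -
      obtain x xs where as: "length (x # xs) = k" "v = wedge (x # xs)"
      proof -
        obtain as where "length as = k" "v = wedge as" using v(1) by (auto simp: decomposable_def)
        then show ?thesis using that k by (cases as) auto
      qed
      have "- v = wedge ((-1) *\<^sub>R x # xs)" using wedge_scaleR[of "[]" "-1" x xs] as by simp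
      then show ?thesis using as(1) v0 unfolding decomposable_def by (auto intro!: exI[of _ "(-1) *\<^sub>R x # xs"])
    qed
    ultimately show ?thesis by blast
  qed
qed

end

theorem theorem6:
  fixes e :: "nat \<Rightarrow> real ^ 'n"
    and n k :: nat
    and q :: "nat list \<Rightarrow> nat list \<Rightarrow> real"
    and u :: "(real ^ 'n) exterior sym_square"
  assumes "n = CARD('n)" and "1 \<le> k" and "k \<le> n"
    and "inj_on e {1..n}" and "independent (e ` {1..n})" and "span (e ` {1..n}) = UNIV"
    and "u = (\<Sum>(\<alpha>, \<beta>) \<in> {(\<alpha>, \<beta>). \<alpha> \<in> multi_indices n k \<and> \<beta> \<in> multi_indices n k \<and>
                                  (\<alpha> = \<beta> \<or> \<alpha> \<succ> \<beta>)}.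
              q \<alpha> \<beta> *\<^sub>R (basis_wedge e \<alpha> \<or>\<^sub>s basis_wedge e \<beta>))"
    and "u \<noteq> 0"
  shows "u \<in> signed_square n k e ` decomposable k \<longleftrightarrow>
    linear_relations n k q \<and>
    (\<forall>\<alpha>\<in>multi_indices n k. \<forall>\<beta>\<in>multi_indices n k. \<alpha> \<noteq> \<beta> \<longrightarrow>
      (extend_coeff q \<alpha> \<beta>)\<^sup>2 - 4 * extend_coeff q \<alpha> \<alpha> * extend_coeff q \<beta> \<beta> = 0) \<and>
    (\<forall>\<alpha>\<in>multi_indices n k. \<forall>\<beta>\<in>multi_indices n k. \<forall>\<gamma>\<in>multi_indices n k.
      \<alpha> \<noteq> \<beta> \<and> \<alpha> \<noteq> \<gamma> \<and> \<beta> \<noteq> \<gamma> \<longrightarrow>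
      extend_coeff q \<alpha> \<beta> * extend_coeff q \<alpha> \<gamma>
        - 2 * extend_coeff q \<alpha> \<alpha> * extend_coeff q \<beta> \<gamma> = 0)"
proof -
  interpret indexed_basis e n k by unfold_locales (fact assms)+
  have u: "u = sym_combination q"
    using assms(7) by (simp only: sym_combination_def index_pairs_def)
  show ?thesis (is "?L \<longleftrightarrow> ?R")
  proof
    assume ?L
    then show ?R using signed_square_imp_relations unfolding u by auto
  next
    assume ?R
    then show ?L using relations_imp_signed_square[OF assms(2), of q] assms(8) unfolding u by auto
  qed
qed

end
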